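(* Let $L>0$, $\mu=\pi/L$, $a>0$, and let $(u,\omega)$ be a smooth solution on $[0,T)$, $L$-periodic in $z$, of the 1D model $$u_t + v u_z = 0,\qquad \omega_t + v\omega_z = u_z,\qquad v_z = H\omega,$$ with $v(\cdot,t)$ of zero mean, and with initial data $$u_0(z)=a\sin^2(\mu z),\qquad \omega_0(z)=0.$$ Suppose that the velocity satisfies the convexity condition $v_{zz}(z,t)\ge 0$ for all $z\in(0,\tfrac12 L)$ and all $t\in[0,T)$. Then, with $$c_0=\Big[\frac{\mu}{L}\int_0^L u_0(z)\cot^2(\mu z)\,dz\Big]^{1/2}=(\tfrac12 a\mu)^{1/2},$$ one has $$-v_z(0,t)=|v_z(0,t)|\ \ge\ 2c_0\tan(\tfrac12 c_0 t)\qquad\text{for all } t\in[0,T).$$ Consequently $T\le \pi/c_0=\sqrt{2\pi L/a}$, i.e. the solution blows up no later than time $\sqrt{2\pi L/a}$.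
   Context: The symbol $H$ applied to a function denotes the periodic Hilbert transform $H\omega(z)=\frac1L\,\mathrm{P.V.}\int_0^L\omega(y)\cot[\mu(z-y)]\,dy$, $\mu=\pi/L$. At each time the velocity $v$ is the unique $L$-periodic function of zero mean over $[0,L]$ with $v_z=H\omega$. "Smooth solution on $[0,T)$" means $u,\omega$ are $C^\infty$ functions on $\mathbb{R}\times[0,T)$, $L$-periodic in $z$, satisfying the equations pointwise. *)

theory Defs
  imports "HOL-Analysis.Analysis"
begin

(* The interval [0,T); T = \<infinity> is allowed, so that global solutions are covered. *)
definition times_upto :: "ereal \<Rightarrow> real set" where
  "times_upto T = {t. 0 \<le> t \<and> ereal t < T}"

text \<open>Space-time functions take the space variable first: \<open>f z t\<close>.\<close>

definition dz :: "(real \<Rightarrow> real \<Rightarrow> real) \<Rightarrow> real \<Rightarrow> real \<Rightarrow> real" where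
  "dz f z t = deriv (\<lambda>x. f x t) z"

(* One-sided at t = 0. *)
definition dt :: "ereal \<Rightarrow> (real \<Rightarrow> real \<Rightarrow> real) \<Rightarrow> real \<Rightarrow> real \<Rightarrow> real" where
  "dt T f z t = vector_derivative (\<lambda>s. f z s) (at t within times_upto T)"

primrec Ck_spacetime :: "ereal \<Rightarrow> nat \<Rightarrow> (real \<Rightarrow> real \<Rightarrow> real) \<Rightarrow> bool" where
  "Ck_spacetime T 0 f \<longleftrightarrow> continuous_on (UNIV \<times> times_upto T) (\<lambda>(z, t). f z t)"
| "Ck_spacetime T (Suc k) f \<longleftrightarrow>
     continuous_on (UNIV \<times> times_upto T) (\<lambda>(z, t). f z t) \<and>
     (\<forall>z. \<forall>t\<in>times_upto T.
        (\<lambda>x. f x t) differentiable (at z) \<and>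
        (\<lambda>s. f z s) differentiable (at t within times_upto T)) \<and>
     Ck_spacetime T k (dz f) \<and> Ck_spacetime T k (dt T f)"

definition smooth_spacetime :: "ereal \<Rightarrow> (real \<Rightarrow> real \<Rightarrow> real) \<Rightarrow> bool" where
  "smooth_spacetime T f \<longleftrightarrow> (\<forall>k. Ck_spacetime T k f)"

text \<open>Periodic Hilbert transform. The kernel is singular at all points of \<open>z + L\<int>\<close>, so the
  principal value removes from \<open>[0,L]\<close> the \<open>\<epsilon>\<close>-neighbourhoods of all of them; in
  particular, for \<open>z = 0\<close> it removes \<open>\<epsilon>\<close>-pieces at both ends of \<open>[0,L]\<close>.\<close>
definition hilbert :: "real \<Rightarrow> (real \<Rightarrow> real) \<Rightarrow> real \<Rightarrow> real" where
  "hilbert L w z = (1 / L) *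
     Lim (at_right 0) (\<lambda>\<epsilon>. integral {y \<in> {0..L}. \<forall>k::int. \<epsilon> \<le> \<bar>y - (z + of_int k * L)\<bar>}
                              (\<lambda>y. w y * cot (pi / L * (z - y))))"

text \<open>\<open>v(\<cdot>,t)\<close> is the periodic zero-mean velocity generated by \<open>\<omega>(\<cdot>,t)\<close>.\<close>
definition is_velocity :: "real \<Rightarrow> (real \<Rightarrow> real) \<Rightarrow> (real \<Rightarrow> real) \<Rightarrow> bool" where
  "is_velocity L w v \<longleftrightarrow>
     (\<forall>z. v (z + L) = v z) \<and>
     (\<forall>z. (v has_real_derivative hilbert L w z) (at z)) \<and>
     integral {0..L} v = 0"

definition smooth_solution ::
  "real \<Rightarrow> ereal \<Rightarrow> (real \<Rightarrow> real \<Rightarrow> real) \<Rightarrow> (real \<Rightarrow> real \<Rightarrow> real) \<Rightarrow> (real \<Rightarrow> real \<Rightarrow> real) \<Rightarrow> bool" where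
  "smooth_solution L T u \<omega> v \<longleftrightarrow>
     smooth_spacetime T u \<and> smooth_spacetime T \<omega> \<and>
     (\<forall>t\<in>times_upto T.
        (\<forall>z. u (z + L) t = u z t) \<and>
        (\<forall>z. \<omega> (z + L) t = \<omega> z t) \<and>
        is_velocity L (\<lambda>z. \<omega> z t) (\<lambda>z. v z t) \<and>
        (\<forall>z. dt T u z t + v z t * dz u z t = 0) \<and>
        (\<forall>z. dt T \<omega> z t + v z t * dz \<omega> z t = dz u z t))"

end

theory Submission imports Defs begin

text \<open>
  Write \<open>\<mu> = \<pi>/L\<close>, \<open>f = -v_z(0,t)\<close> (the constant \<open>strain\<close>) and \<open>g = (2/L) \<integral> u_z cot \<mu>z dz\<close> over the
  half period \<open>[0, L/2]\<close> (the constant \<open>gradient_moment\<close>). The theorem follows from the two differential inequalities \<open>f' \<ge> g\<close> and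
  \<open>g' \<ge> f g / 2\<close>, because \<open>F = 2 c tan (c t / 2)\<close> and \<open>F' = c\<^sup>2 sec\<^sup>2 (c t / 2)\<close> solve the
  corresponding system of equations, the system is cooperative, and initially \<open>f = 0\<close> and
  \<open>g = a \<mu> = 2 c\<^sub>0\<^sup>2\<close> (\<open>tan_comparison\<close>, \<open>v_z_lower_bound\<close>).
  If \<open>T\<close> exceeded \<open>\<pi>/c\<^sub>0\<close>, the tangent would force \<open>v_z(0,t)\<close> to be unbounded on a compact time
  interval on which the solution is smooth (\<open>blowup_time\<close>).

  The data make \<open>u\<close> even and \<open>\<omega>, v\<close> odd at time \<open>0\<close>, and this persists because smooth solutions
  are unique: the even parts of \<open>\<omega>\<close> and \<open>u_z\<close> satisfy a linear transport system, and since
  the sup norm of the Hilbert transform of \<open>w\<close> is at most of order \<open>|w| log (1/|w|)\<close> when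
  \<open>w_z\<close> is bounded (\<open>hilbert_sym_bound\<close>), they stay below the barrier
  \<open>exp (-N e\<^sup>-\<^sup>A\<^sup>t)\<close> for every \<open>N\<close> (\<open>even_parts_vanish\<close>).
  By symmetry \<open>f = (2/L) \<integral> \<omega> cot \<mu>z dz\<close>, and \<open>v\<close> vanishes at \<open>0\<close> and \<open>L/2\<close>, so the half period
  is invariant under the flow. On it a minimum principle gives \<open>u_z \<ge> 0\<close> and \<open>\<omega> \<ge> 0\<close>,
  and, as \<open>v_z\<close> increases, that \<open>\<omega>/u_z\<close> increases, in the form
  \<open>\<omega>(x) u_z(y) \<le> \<omega>(y) u_z(x)\<close> for \<open>x \<le> y\<close> (\<open>ratio_increasing\<close>).

  For the first inequality, \<open>f' - g = -(2/L) \<integral> v \<omega>_z cot = (2/L) \<integral> \<omega> (v cot)_z\<close>, which is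
  nonnegative because convexity of \<open>v\<close> makes \<open>v cot\<close> increasing (\<open>v_cot_increasing\<close>). For the second,
  \<open>g' = -(2/L) \<integral> (v u_z)_z cot = -(2/L) \<integral> \<mu> v u_z / sin\<^sup>2\<close>. The velocity is the Hilbert
  transform of the primitive of \<open>\<omega>\<close>, and its kernel folded onto the half period has the sign needed for
  \<open>-\<mu> v(z) \<ge> sin \<mu>z cos \<mu>z G(z)\<close> with \<open>G(z) = (2/L) \<integral> \<omega> cot \<mu>y dy\<close> over \<open>[z, L/2]\<close>
  (\<open>v_upper_bound\<close>). Hence \<open>g' \<ge> (2/L) \<integral> u_z cot G\<close>. Here \<open>G\<close> integrates \<open>\<omega> cot\<close> over
  \<open>y \<ge> z\<close> only, but since \<open>\<omega>/u_z\<close> increases, this part of the double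
  integral is at least half of \<open>f g\<close>.
\<close>

section \<open>Integrals against the cotangent, and periodic functions\<close>

text \<open>The quotient equals \<open>\<integral> F' (\<theta> s) p d\<theta>\<close> over \<open>[0, 1]\<close>, which shows that it is jointly continuous up to \<open>s = 0\<close>.\<close>

lemma difference_quotient_continuous:
  fixes F F' :: "real \<Rightarrow> 'p::topological_space \<Rightarrow> real"
  assumes "b \<ge> 0"
    and F': "\<And>s p. s \<in> {0..b} \<Longrightarrow> p \<in> P \<Longrightarrow> ((\<lambda>s. F s p) has_real_derivative F' s p) (at s within {0..b})"
    and F0: "\<And>p. p \<in> P \<Longrightarrow> F 0 p = 0"
    and cont: "continuous_on ({0..b} \<times> P) (\<lambda>(s, p). F' s p)"
  shows "continuous_on ({0..b} \<times> P) (\<lambda>(s, p). if s = 0 then F' 0 p else F s p / s)"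
proof -
  let ?q = "\<lambda>x. integral (cbox 0 1) (\<lambda>\<theta>. F' (\<theta> * fst x) (snd x))"
  have "continuous_on (({0..b} \<times> P) \<times> cbox 0 (1::real)) (\<lambda>(x, \<theta>). F' (\<theta> * fst x) (snd x))"
    unfolding split_beta
    by (rule continuous_on_compose2[OF cont[unfolded split_beta], where f="\<lambda>x. (snd x * fst (fst x), snd (fst x))", simplified])
       (auto intro!: continuous_intros simp: mult_le_one intro: order_trans[OF mult_left_le_one_le])
  then have c: "continuous_on ({0..b} \<times> P) ?q"
    by (rule integral_continuous_on_param)
  have "?q (s, p) = (if s = 0 then F' 0 p else F s p / s)" if s: "s \<in> {0..b}" and p: "p \<in> P" for s p
  proof (cases "s = 0")
    case False
    have "((\<lambda>\<theta>. F' (\<theta> * s) p * s) has_integral F (1 * s) p - F (0 * s) p) {0..1}"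
    proof (rule fundamental_theorem_of_calculus)
      fix \<theta> :: real assume \<theta>: "\<theta> \<in> {0..1}"
      have m: "\<theta>' * s \<in> {0..b}" if "\<theta>' \<in> {0..1}" for \<theta>'
        using s that by (auto intro: order_trans[OF mult_left_le_one_le])
      have "((\<lambda>s. F s p) \<circ> (\<lambda>\<theta>. \<theta> * s) has_real_derivative F' (\<theta> * s) p * s) (at \<theta> within {0..1})"
      proof (rule DERIV_image_chain)
        show "((\<lambda>s. F s p) has_real_derivative F' (\<theta> * s) p) (at (\<theta> * s) within (\<lambda>\<theta>. \<theta> * s) ` {0..1})"
          by (rule DERIV_subset[OF F'[OF m[OF \<theta>] p]]) (use m in auto)
      qed (auto intro!: derivative_eq_intros)
      then show "((\<lambda>\<theta>. F (\<theta> * s) p) has_vector_derivative F' (\<theta> * s) p * s) (at \<theta> within {0..1})"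
        by (simp add: o_def has_real_derivative_iff_has_vector_derivative)
    qed simp
    then have "((\<lambda>\<theta>. F' (\<theta> * s) p) has_integral (F s p / s)) {0..1}"
      using False has_integral_divide[of "\<lambda>\<theta>. F' (\<theta> * s) p * s" _ "{0..1}" s] F0[OF p] by simp
    then show ?thesis using False by (simp add: integral_unique)
  qed simp
  then show ?thesis
    by (intro continuous_on_eq[OF c]) auto
qed

lemma s_cot_continuous:
  assumes "L > 0"
  shows "continuous_on {0..L/2} (\<lambda>s. if s = 0 then L / pi else s * cot (pi / L * s))"
proof -
  have "continuous_on ({0..L/2} \<times> {0::real}) (\<lambda>(s, p). if s = 0 then pi / L * cos (pi / L * 0) else sin (pi / L * s) / s)"
    by (rule difference_quotient_continuous[where F="\<lambda>s p. sin (pi / L * s)" and F'="\<lambda>s p. pi / L * cos (pi / L * s)"])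
       (use assms in \<open>auto intro!: derivative_eq_intros continuous_intros simp: split_beta\<close>)
  from continuous_on_compose2[OF this, of "{0..L/2}" "\<lambda>s. (s, 0::real)"]
  have c: "continuous_on {0..L/2} (\<lambda>s. if s = 0 then pi / L else sin (pi / L * s) / s)"
    by (simp add: continuous_intros image_subset_iff cong: if_cong)
  have pos: "(if s = 0 then pi / L else sin (pi / L * s) / s) \<noteq> 0" if "s \<in> {0..L/2}" for s
  proof -
    have "sin (pi / L * s) > 0" if "s \<noteq> 0"
      by (rule sin_gt_zero) (use assms that \<open>s \<in> _\<close> pi_gt_zero in \<open>auto simp: field_simps\<close>)
    then show ?thesis using assms by auto
  qed
  have "continuous_on {0..L/2} (\<lambda>s. cos (pi / L * s) / (if s = 0 then pi / L else sin (pi / L * s) / s))"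
    by (intro continuous_intros c) (use pos in auto)
  then show ?thesis
    by (rule continuous_on_eq) (auto simp: cot_def)
qed

text \<open>\<open>cot_ext\<close> is the continuous extension of \<open>F s * cot (\<pi> s / L)\<close> to \<open>s = 0\<close> when
  \<open>F 0 = 0\<close> and \<open>d\<close> is the derivative of \<open>F\<close> there.\<close>
definition cot_ext :: "real \<Rightarrow> real \<Rightarrow> (real \<Rightarrow> real) \<Rightarrow> real \<Rightarrow> real" where
  "cot_ext L d F s = (if s = 0 then d * (L / pi) else F s * cot (pi / L * s))"

lemma cot_ext_continuous:
  fixes F F' :: "real \<Rightarrow> 'p::topological_space \<Rightarrow> real"
  assumes L: "L > 0"
    and F': "\<And>s p. s \<in> {0..L/2} \<Longrightarrow> p \<in> P \<Longrightarrow> ((\<lambda>s. F s p) has_real_derivative F' s p) (at s within {0..L/2})"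
    and F0: "\<And>p. p \<in> P \<Longrightarrow> F 0 p = 0"
    and cont: "continuous_on ({0..L/2} \<times> P) (\<lambda>(s, p). F' s p)"
  shows "continuous_on ({0..L/2} \<times> P) (\<lambda>(s, p). cot_ext L (F' 0 p) (\<lambda>s. F s p) s)"
proof -
  have "continuous_on ({0..L/2} \<times> P) (\<lambda>(s, p). if s = 0 then F' 0 p else F s p / s)"
    by (rule difference_quotient_continuous[OF _ assms(2-4)]) (use L in auto)
  moreover have "continuous_on ({0..L/2} \<times> P) (\<lambda>x. if fst x = 0 then L / pi else fst x * cot (pi / L * fst x))"
    by (rule continuous_on_compose2[OF s_cot_continuous[OF L]]) (auto intro!: continuous_intros)
  ultimately have "continuous_on ({0..L/2} \<times> P) (\<lambda>x. (\<lambda>(s, p). if s = 0 then F' 0 p else F s p / s) x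
      * (if fst x = 0 then L / pi else fst x * cot (pi / L * fst x)))"
    by (intro continuous_intros)
  then show ?thesis
    by (rule continuous_on_eq) (auto simp: cot_ext_def)
qed

lemma cot_ext_continuous1:
  assumes L: "L > 0"
    and F': "\<And>s. s \<in> {0..L/2} \<Longrightarrow> (F has_real_derivative F' s) (at s within {0..L/2})"
    and F0: "F 0 = 0"
    and cont: "continuous_on {0..L/2} F'"
  shows "continuous_on {0..L/2} (cot_ext L (F' 0) F)"
proof -
  have "continuous_on ({0..L/2} \<times> {0::real}) (\<lambda>(s, p). cot_ext L (F' 0) F s)"
    by (rule cot_ext_continuous[OF L, where F="\<lambda>s p. F s" and F'="\<lambda>s p. F' s"])
      (use F' F0 in \<open>auto simp: split_beta intro!: continuous_intros continuous_on_compose2[OF cont]\<close>)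
  from continuous_on_compose2[OF this, of "{0..L/2}" "\<lambda>s. (s, 0::real)"]
  show ?thesis by (simp add: continuous_intros image_subset_iff)
qed

lemma has_integral_cot_ext_iff:
  "(cot_ext L d F has_integral I) {a..b} \<longleftrightarrow> ((\<lambda>s. F s * cot (pi / L * s)) has_integral I) {a..b}"
  by (rule has_integral_spike_finite_eq[of "{0}"]) (auto simp: cot_ext_def)

lemma integral_cot_ext:
  "integral {a..b} (cot_ext L d F) = integral {a..b} (\<lambda>s. F s * cot (pi / L * s))"
  unfolding integral_def integrable_on_def has_integral_cot_ext_iff ..

lemma integrable_cot:
  assumes "L > 0"
    and "\<And>s. s \<in> {0..L/2} \<Longrightarrow> (F has_real_derivative F' s) (at s within {0..L/2})"
    and "F 0 = 0"
    and "continuous_on {0..L/2} F'"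
  shows "(\<lambda>s. F s * cot (pi / L * s)) integrable_on {0..L/2}"
  using integrable_continuous_interval[OF cot_ext_continuous1[OF assms]]
  unfolding integrable_on_def has_integral_cot_ext_iff .

text \<open>Differentiation under the integral sign needs jointly continuous integrands, so it is applied to the
  continuous extensions \<open>cot_ext\<close>; at \<open>s = 0\<close> their values are derivatives of \<open>F\<close>, whence the hypothesis
  on the mixed derivative there.\<close>

lemma leibniz_cot:
  fixes F Fs Fp Fps :: "real \<Rightarrow> real \<Rightarrow> real" and U :: "real set"
  assumes L: "L > 0" and U: "convex U" "p0 \<in> U"
    and F0: "\<And>p. p \<in> U \<Longrightarrow> F 0 p = 0"
    and Fs: "\<And>s p. s \<in> {0..L/2} \<Longrightarrow> p \<in> U \<Longrightarrow> ((\<lambda>s. F s p) has_real_derivative Fs s p) (at s)"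
    and Fp: "\<And>s p. s \<in> {0..L/2} \<Longrightarrow> p \<in> U \<Longrightarrow> ((\<lambda>p. F s p) has_real_derivative Fp s p) (at p within U)"
    and Fps: "\<And>s p. s \<in> {0..L/2} \<Longrightarrow> p \<in> U \<Longrightarrow> ((\<lambda>s. Fp s p) has_real_derivative Fps s p) (at s)"
    and Fsp: "\<And>p. p \<in> U \<Longrightarrow> ((\<lambda>p. Fs 0 p) has_real_derivative Fps 0 p) (at p within U)"
    and Fp0: "\<And>p. p \<in> U \<Longrightarrow> Fp 0 p = 0"
    and cFs: "continuous_on ({0..L/2} \<times> U) (\<lambda>(s, p). Fs s p)"
    and cFps: "continuous_on ({0..L/2} \<times> U) (\<lambda>(s, p). Fps s p)"
  shows "((\<lambda>p. integral {0..L/2} (\<lambda>s. F s p * cot (pi / L * s))) has_real_derivative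
          integral {0..L/2} (\<lambda>s. Fp s p0 * cot (pi / L * s))) (at p0 within U)"
proof -
  have "((\<lambda>p. integral (cbox 0 (L/2)) (\<lambda>s. cot_ext L (Fs 0 p) (\<lambda>s. F s p) s)) has_field_derivative
     integral (cbox 0 (L/2)) ((\<lambda>p s. cot_ext L (Fps 0 p) (\<lambda>s. Fp s p) s) p0)) (at p0 within U)"
  proof (rule leibniz_rule_field_derivative)
    fix p s assume p: "p \<in> U" and s: "s \<in> cbox 0 (L/2)"
    show "((\<lambda>p. cot_ext L (Fs 0 p) (\<lambda>s. F s p) s) has_real_derivative cot_ext L (Fps 0 p) (\<lambda>s. Fp s p) s) (at p within U)"
      by (cases "s = 0")
        (use p s in \<open>auto simp: cot_ext_def simp del: times_divide_eq_right intro!: DERIV_cmult_right Fp Fsp\<close>)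
  next
    fix p assume p: "p \<in> U"
    have "continuous_on {0..L/2} (cot_ext L (Fs 0 p) (\<lambda>s. F s p))"
      by (rule cot_ext_continuous1[OF L])
        (use p in \<open>auto intro!: F0 DERIV_subset[OF Fs] continuous_intros continuous_on_compose2[OF cFs, where f="\<lambda>s. (s, p)", simplified]\<close>)
    then show "(\<lambda>s. cot_ext L (Fs 0 p) (\<lambda>s. F s p) s) integrable_on cbox 0 (L/2)"
      by (simp add: integrable_continuous_interval)
  next
    have c: "continuous_on ({0..L/2} \<times> U) (\<lambda>(s, p). cot_ext L (Fps 0 p) (\<lambda>s. Fp s p) s)"
      by (rule cot_ext_continuous[OF L _ _ cFps]) (auto intro!: Fp0 DERIV_subset[OF Fps])
    show "continuous_on (U \<times> cbox 0 (L/2)) (\<lambda>(p, s). cot_ext L (Fps 0 p) (\<lambda>s. Fp s p) s)"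
      using continuous_on_compose2[OF c, of "U \<times> cbox 0 (L/2)" "\<lambda>x. (snd x, fst x)"]
      by (simp add: split_beta continuous_intros image_subset_iff mem_Times_iff)
  qed (use U in auto)
  then show ?thesis by (simp add: integral_cot_ext)
qed

lemma periodic_shift_int:
  fixes f :: "real \<Rightarrow> 'b" and L :: real
  assumes "\<And>x. f (x + L) = f x"
  shows "f (x + of_int k * L) = f x"
proof (induction k rule: int_induct[where k=0])
  case base then show ?case by simp
next
  case (step1 i)
  then show ?case using assms[of "x + of_int i * L"] by (simp add: algebra_simps)
next
  case (step2 i)
  then show ?case using assms[of "x + of_int (i - 1) * L"] by (simp add: algebra_simps)
qed

lemma has_integral_periodic:
  fixes f :: "real \<Rightarrow> real"
  assumes L: "L > 0" and per: "\<And>x. f (x + L) = f x" and I: "(f has_integral I) {a..a+L}"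
  shows "(f has_integral I) {b..b+L}"
proof -
  define k where "k = \<lfloor>(b - a) / L\<rfloor>"
  define r where "r = b - a - of_int k * L"
  have "of_int k \<le> (b - a) / L" "(b - a) / L < of_int k + 1"
    unfolding k_def by linarith+
  then have r: "0 \<le> r" "r < L"
    unfolding r_def using L by (auto simp: field_simps)
  have i1: "f integrable_on {a..a+r}" "f integrable_on {a+r..a+L}"
    using I r by (auto intro: integrable_subinterval_real)
  have "integral {a..a+r} f + integral {a+r..a+L} f = I"
    using Henstock_Kurzweil_Integration.integral_combine[where a=a and c="a+r" and b="a+L" and f=f] I r by (auto simp: has_integral_iff)
  moreover have "(f has_integral integral {a..a+r} f) {a+L..a+r+L}"
    using has_integral_shift_real_ivl[of f _ a "a+r" "-L"] i1(1) per[of "_ - L"]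
    by (auto simp: has_integral_iff)
  ultimately have "(f has_integral I) {a+r..a+r+L}"
    using has_integral_combine[of "a+r" "a+L" "a+r+L" f "integral {a+r..a+L} f" "integral {a..a+r} f"] i1(2) r
    by (auto simp: add.commute)
  from has_integral_shift_real_ivl[OF this, of "- (of_int k * L)"]
  have "((\<lambda>x. f (x + of_int (- k) * L)) has_integral I) {a + r + of_int k * L..a + r + L + of_int k * L}"
    by (simp add: algebra_simps)
  then show ?thesis
    unfolding periodic_shift_int[of f L, OF per]
    by (simp add: r_def algebra_simps)
qed

section \<open>The periodic Hilbert transform\<close>

text \<open>Pairing the points \<open>z - s\<close> and \<open>z + s\<close> cancels the singularity of the kernel: for differentiable \<open>w\<close> this is an
  absolutely convergent form of the principal value integral.\<close>

definition hilbert_sym :: "real \<Rightarrow> (real \<Rightarrow> real) \<Rightarrow> real \<Rightarrow> real" where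
  "hilbert_sym L w z = 1 / L * integral {0..L/2} (\<lambda>s. (w (z - s) - w (z + s)) * cot (pi / L * s))"

lemma sin_pos_half:
  fixes L s :: real
  assumes "0 < s" "s < L"
  shows "sin (pi / L * s) > 0"
  by (rule sin_gt_zero) (use assms in \<open>auto simp: field_simps\<close>)

lemma sin_half_mono:
  fixes L y z :: real
  assumes "0 \<le> y" "y < z" "z \<le> L/2"
  shows "sin (pi / L * y) < sin (pi / L * z)"
proof (rule sin_monotone_2pi)
  have L: "L > 0" using assms by auto
  have "pi / L * z \<le> pi / L * (L / 2)" using assms L by (intro mult_left_mono) auto
  then show "pi / L * z \<le> pi / 2" using L by simp
  have "0 \<le> pi / L * y" using assms L by simp
  then show "- (pi / 2) \<le> pi / L * y" using pi_gt_zero by linarith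
  show "pi / L * y < pi / L * z" using assms L by (intro mult_strict_left_mono) auto
qed

lemma cot_bounds:
  fixes x :: real
  assumes "0 < x" "x \<le> pi / 2"
  shows "0 \<le> cot x" "cot x \<le> 1 / x"
proof -
  have s: "sin x > 0" and c: "cos x \<ge> 0"
    using assms by (auto intro!: sin_gt_zero cos_ge_zero)
  then show "0 \<le> cot x" by (simp add: cot_def)
  show "cot x \<le> 1 / x"
  proof (cases "x = pi / 2")
    case False
    then have "x \<le> tan x" using abs_tan_ge[of x] assms tan_gt_zero[of x] by auto
    moreover have "cos x > 0" using assms False by (intro cos_gt_zero_pi) auto
    ultimately have "x * cos x \<le> sin x" by (simp add: tan_def field_simps)
    then show ?thesis using s assms by (simp add: cot_def field_simps)
  next
    case True
    then have "cos x = 0" using cos_pi_half by blast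
    then show ?thesis using assms by (simp add: cot_def)
  qed
qed

lemma cot_bounds_half:
  fixes L s :: real
  assumes "0 < s" "s \<le> L/2"
  shows "0 \<le> cot (pi / L * s)" "cot (pi / L * s) \<le> L / (pi * s)"
  using cot_bounds[of "pi / L * s"] assms by (auto simp: field_simps)

lemma cot_half [simp]: "L > 0 \<Longrightarrow> cot (pi / L * (L / 2)) = 0"
  by (simp add: cot_def)

lemma cot_diff_periodic:
  fixes L :: real
  assumes "L > 0"
  shows "cot (pi / L * (x + L)) = cot (pi / L * x)"
proof -
  have "pi / L * (x + L) = pi / L * x + pi" using assms by (simp add: field_simps)
  then show ?thesis by (simp add: cot_def)
qed

lemma cot_diff_periodic':
  fixes L :: real
  assumes "L > 0"
  shows "cot (pi / L * (x - L)) = cot (pi / L * x)"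
  using cot_diff_periodic[OF assms, of "x - L"] by simp

lemma dist_lattice_ge:
  fixes s L \<epsilon> :: real
  assumes "\<epsilon> \<le> \<bar>s\<bar>" "\<bar>s\<bar> \<le> L / 2" "L > 0"
  shows "\<epsilon> \<le> \<bar>s - of_int k * L\<bar>"
proof (cases "k = 0")
  case False
  then have "\<bar>of_int k * L\<bar> \<ge> L" using assms
    by (simp add: abs_mult)
  then show ?thesis using assms by linarith
qed (use assms in auto)

text \<open>The truncated integrand is periodic, so the period \<open>[0, L]\<close> may be replaced by the one centred at \<open>z\<close>,
  where the truncation removes a single interval.\<close>

lemma truncated_hilbert:
  fixes w :: "real \<Rightarrow> real"
  assumes L: "L > 0" and per: "\<And>x. w (x + L) = w x" and cw: "continuous_on UNIV w"
    and e: "0 < \<epsilon>" "\<epsilon> < L / 2"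
  shows "integral {y \<in> {0..L}. \<forall>k::int. \<epsilon> \<le> \<bar>y - (z + of_int k * L)\<bar>} (\<lambda>y. w y * cot (pi / L * (z - y)))
     = integral {\<epsilon>..L/2} (\<lambda>s. (w (z - s) - w (z + s)) * cot (pi / L * s))"
proof -
  define S where "S = {y. \<forall>k::int. \<epsilon> \<le> \<bar>y - (z + of_int k * L)\<bar>}"
  define F where "F y = w y * cot (pi / L * (z - y))" for y
  define FS where "FS y = (if y \<in> S then F y else 0)" for y
  have S_per: "y + L \<in> S \<longleftrightarrow> y \<in> S" for y
  proof -
    have "(\<forall>k::int. \<epsilon> \<le> \<bar>y + L - (z + of_int k * L)\<bar>) \<longleftrightarrow> (\<forall>k::int. \<epsilon> \<le> \<bar>y - (z + of_int k * L)\<bar>)"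
    proof safe
      fix k :: int assume "\<forall>k::int. \<epsilon> \<le> \<bar>y + L - (z + of_int k * L)\<bar>"
      from spec[OF this, of "k + 1"] show "\<epsilon> \<le> \<bar>y - (z + of_int k * L)\<bar>" by (simp add: algebra_simps)
    next
      fix k :: int assume "\<forall>k::int. \<epsilon> \<le> \<bar>y - (z + of_int k * L)\<bar>"
      from spec[OF this, of "k - 1"] show "\<epsilon> \<le> \<bar>y + L - (z + of_int k * L)\<bar>" by (simp add: algebra_simps)
    qed
    then show ?thesis by (simp add: S_def)
  qed
  have FS_per: "FS (y + L) = FS y" for y
  proof -
    have "cot (pi / L * (z - (y + L))) = cot (pi / L * (z - y))"
      using cot_diff_periodic'[OF L, of "z - y"] by (simp add: algebra_simps)
    then show ?thesis by (simp add: FS_def S_per F_def per)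
  qed
  have inS: "z + s \<in> S" if "\<epsilon> \<le> \<bar>s\<bar>" "\<bar>s\<bar> \<le> L / 2" for s
  proof -
    have "\<epsilon> \<le> \<bar>z + s - (z + of_int k * L)\<bar>" for k :: int
      using dist_lattice_ge[OF that L, of k] by (simp add: algebra_simps)
    then show ?thesis by (simp add: S_def)
  qed
  have notS: "z + s \<notin> S" if "\<bar>s\<bar> < \<epsilon>" for s
    using that by (auto simp: S_def intro!: exI[of _ 0])
  have sn: "sin (pi * s / L) \<noteq> 0" if "\<epsilon> \<le> s" "s \<le> L/2" for s
    using sin_pos_half[of s L] that e by auto
  have c0: "continuous_on {\<epsilon>..L/2} (\<lambda>s. cot (pi / L * s))"
    by (rule continuous_on_cot) (use sn in \<open>auto intro!: continuous_intros\<close>)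
  have cw': "continuous_on {\<epsilon>..L/2} (\<lambda>s. w (z - s))" "continuous_on {\<epsilon>..L/2} (\<lambda>s. w (z + s))"
    by (intro continuous_on_compose2[OF cw] continuous_intros; simp)+
  note c1 = continuous_on_mult[OF cw'(1) c0] continuous_on_mult[OF cw'(2) c0]
  define I1 where "I1 = integral {\<epsilon>..L/2} (\<lambda>s. w (z - s) * cot (pi / L * s))"
  define I2 where "I2 = integral {\<epsilon>..L/2} (\<lambda>s. w (z + s) * cot (pi / L * s))"
  have h1: "((\<lambda>s. w (z - s) * cot (pi / L * s)) has_integral I1) {\<epsilon>..L/2}"
    and h2: "((\<lambda>s. w (z + s) * cot (pi / L * s)) has_integral I2) {\<epsilon>..L/2}"
    unfolding I1_def I2_def by (rule integrable_integral, rule integrable_continuous_interval, rule c1)+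
  have cm: "cot (- x) = - cot x" for x :: real by (simp add: cot_def)
  have "((\<lambda>s. FS (s + z)) has_integral - I2) {\<epsilon>..L/2}"
    by (rule has_integral_eq[OF _ has_integral_neg[OF h2]])
      (use inS e in \<open>auto simp: FS_def F_def add.commute cm\<close>)
  from has_integral_shift_real_ivl[OF this, of "-z"]
  have r: "(FS has_integral - I2) {z + \<epsilon>..z + L/2}" by (simp add: add.commute)
  have "((\<lambda>s. FS (z - s)) has_integral I1) {\<epsilon>..L/2}"
    by (rule has_integral_eq[OF _ h1]) (use inS[of "- s" for s] e in \<open>auto simp: FS_def F_def\<close>)
  then have "((\<lambda>s. FS (s + z)) has_integral I1) {- (L/2)..-\<epsilon>}"
    by (subst has_integral_reflect_real[symmetric]) simp
  from has_integral_shift_real_ivl[OF this, of "-z"]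
  have l: "(FS has_integral I1) {z - L/2..z - \<epsilon>}" by (simp add: add.commute)
  have m: "(FS has_integral 0) {z - \<epsilon>..z + \<epsilon>}"
  proof (rule has_integral_spike_finite[OF _ _ has_integral_0])
    show "finite {z - \<epsilon>, z + \<epsilon>}" by simp
    fix y assume "y \<in> {z - \<epsilon>..z + \<epsilon>} - {z - \<epsilon>, z + \<epsilon>}"
    then show "FS y = 0" using notS[of "y - z"] by (auto simp: FS_def abs_less_iff)
  qed
  have "(FS has_integral (I1 + 0 + - I2)) {z - L/2..z + L/2}"
    by (rule has_integral_combine[OF _ _ has_integral_combine[OF _ _ l m] r]) (use e in auto)
  then have "(FS has_integral (I1 - I2)) {z - L/2..z - L/2 + L}" by (simp add: field_simps)
  from has_integral_periodic[OF L FS_per this, of 0]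
  have "(FS has_integral (I1 - I2)) {0..L}" by simp
  then have "integral (S \<inter> {0..L}) F = I1 - I2"
    unfolding FS_def[abs_def] using integral_restrict_Int[of "{0..L}" S F] by (simp add: integral_unique)
  moreover have "S \<inter> {0..L} = {y \<in> {0..L}. \<forall>k::int. \<epsilon> \<le> \<bar>y - (z + of_int k * L)\<bar>}"
    by (auto simp: S_def)
  moreover have "integral {\<epsilon>..L/2} (\<lambda>s. (w (z - s) - w (z + s)) * cot (pi / L * s)) = I1 - I2"
    using has_integral_diff[OF h1 h2] by (simp add: algebra_simps integral_unique)
  ultimately show ?thesis by (simp add: F_def[abs_def])
qed

lemma integrable_hilbert_sym:
  assumes L: "L > 0" and w': "\<And>x. (w has_real_derivative w' x) (at x)" and cw': "continuous_on UNIV w'"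
  shows "(\<lambda>s. (w (z - s) - w (z + s)) * cot (pi / L * s)) integrable_on {0..L/2}"
  by (rule integrable_cot[OF L, where F'="\<lambda>s. - w' (z - s) - w' (z + s)"])
    (auto intro!: derivative_eq_intros DERIV_chain2[OF w'] continuous_intros continuous_on_compose2[OF cw'])

lemma hilbert_eq_sym:
  assumes L: "L > 0" and per: "\<And>x. w (x + L) = w x"
    and w': "\<And>x. (w has_real_derivative w' x) (at x)" and cw': "continuous_on UNIV w'"
  shows "hilbert L w z = hilbert_sym L w z"
proof -
  let ?\<Phi> = "\<lambda>s. (w (z - s) - w (z + s)) * cot (pi / L * s)"
  have cw: "continuous_on UNIV w" by (meson DERIV_isCont continuous_at_imp_continuous_on w')
  have "continuous_on {0..L/2} (\<lambda>x. integral {x..L/2} ?\<Phi>)"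
    by (rule indefinite_integral_continuous_1'[OF integrable_hilbert_sym[OF L w' cw']])
  from bspec[OF this[unfolded continuous_on_def], of 0]
  have "((\<lambda>x. integral {x..L/2} ?\<Phi>) \<longlongrightarrow> integral {0..L/2} ?\<Phi>) (at 0 within {0..L/2})"
    using L by (simp only: atLeastAtMost_iff) simp
  then have "((\<lambda>x. integral {x..L/2} ?\<Phi>) \<longlongrightarrow> integral {0..L/2} ?\<Phi>) (at_right 0)"
    using at_within_Icc_at_right[of 0 "L/2"] L by simp
  moreover have "\<forall>\<^sub>F \<epsilon> in at_right 0. \<epsilon> \<in> {0<..<L/2}"
    by (rule eventually_at_right_real) (use L in auto)
  then have "\<forall>\<^sub>F \<epsilon> in at_right 0. integral {\<epsilon>..L/2} ?\<Phi> = integral {y \<in> {0..L}. \<forall>k::int. \<epsilon> \<le> \<bar>y - (z + of_int k * L)\<bar>}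
                              (\<lambda>y. w y * cot (pi / L * (z - y)))"
    by eventually_elim (rule truncated_hilbert[OF L per cw, symmetric]; simp)
  ultimately have "((\<lambda>\<epsilon>. integral {y \<in> {0..L}. \<forall>k::int. \<epsilon> \<le> \<bar>y - (z + of_int k * L)\<bar>}
                              (\<lambda>y. w y * cot (pi / L * (z - y)))) \<longlongrightarrow> integral {0..L/2} ?\<Phi>) (at_right 0)"
    by (rule Lim_transform_eventually)
  then show ?thesis
    unfolding hilbert_def hilbert_sym_def by (simp only: tendsto_Lim[OF trivial_limit_at_right_real])
qed

lemma hilbert_sym_deriv:
  assumes L: "L > 0"
    and w': "\<And>x. (w has_real_derivative w' x) (at x)"
    and w'': "\<And>x. (w' has_real_derivative w'' x) (at x)" and cw'': "continuous_on UNIV w''"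
  shows "(hilbert_sym L w has_real_derivative hilbert_sym L w' z) (at z)"
proof -
  have cw': "continuous_on UNIV w'" by (meson DERIV_isCont continuous_at_imp_continuous_on w'')
  have "((\<lambda>z. integral {0..L/2} (\<lambda>s. (w (z - s) - w (z + s)) * cot (pi / L * s))) has_real_derivative
       integral {0..L/2} (\<lambda>s. (w' (z - s) - w' (z + s)) * cot (pi / L * s))) (at z within UNIV)"
    by (rule leibniz_cot[OF L, where Fs="\<lambda>s z. - w' (z - s) - w' (z + s)" and Fps="\<lambda>s z. - w'' (z - s) - w'' (z + s)"])
      (auto intro!: derivative_eq_intros DERIV_chain2[OF w'] DERIV_chain2[OF w''] continuous_intros
        continuous_on_compose2[OF cw'] continuous_on_compose2[OF cw''] simp: split_beta)
  then have "((\<lambda>z. 1 / L * integral {0..L/2} (\<lambda>s. (w (z - s) - w (z + s)) * cot (pi / L * s))) has_real_derivative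
     1 / L * integral {0..L/2} (\<lambda>s. (w' (z - s) - w' (z + s)) * cot (pi / L * s))) (at z)"
    by (rule DERIV_cmult)
  then show ?thesis unfolding hilbert_sym_def[abs_def] .
qed

text \<open>The difference \<open>w (z - s) - w (z + s)\<close> is at most \<open>2 M s\<close>, which is used for \<open>s \<le> \<delta>\<close>, and at most \<open>2 D\<close>,
  which is used for \<open>s \<ge> \<delta>\<close>; moreover \<open>cot x \<le> 1/x\<close>. With \<open>\<delta>\<close> proportional to \<open>D\<close> this is the log-Lipschitz bound
  on which uniqueness rests.\<close>

lemma hilbert_sym_bound:
  assumes L: "L > 0"
    and w': "\<And>x. (w has_real_derivative w' x) (at x)" and cw': "continuous_on UNIV w'"
    and D: "\<And>x. \<bar>w x\<bar> \<le> D" and M: "\<And>x. \<bar>w' x\<bar> \<le> M"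
    and \<delta>: "0 < \<delta>" "\<delta> \<le> L / 2"
  shows "\<bar>hilbert_sym L w z\<bar> \<le> 2 / pi * (M * \<delta> + D * ln (L / (2 * \<delta>)))"
proof -
  let ?\<Phi> = "\<lambda>s. (w (z - s) - w (z + s)) * cot (pi / L * s)"
  have int: "?\<Phi> integrable_on {0..L/2}" by (rule integrable_hilbert_sym[OF L w' cw'])
  have M0: "M \<ge> 0" using M[of 0] by linarith
  have near: "\<bar>?\<Phi> s\<bar> \<le> 2 * M * L / pi" if "s \<in> {0..\<delta>}" for s
  proof (cases "s = 0")
    case False
    then have s: "0 < s" "s \<le> L/2" using that \<delta> by auto
    have "\<bar>w (z - s) - w (z + s)\<bar> \<le> M * \<bar>(z - s) - (z + s)\<bar>"
      using field_differentiable_bound[of UNIV w w' M "z - s" "z + s"] w' M by auto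
    also have "\<dots> = 2 * M * s" using s by simp
    finally have "\<bar>?\<Phi> s\<bar> \<le> (2 * M * s) * (L / (pi * s))"
      unfolding abs_mult using cot_bounds_half[OF s] s M0 by (intro mult_mono) auto
    also have "\<dots> = 2 * M * L / pi" using s by simp
    finally show ?thesis .
  qed (use M0 L in auto)
  have far: "\<bar>?\<Phi> s\<bar> \<le> 2 * D * L / pi / s" if "s \<in> {\<delta>..L/2}" for s
  proof -
    have s: "0 < s" "s \<le> L/2" using that \<delta> by auto
    have "\<bar>w (z - s) - w (z + s)\<bar> \<le> 2 * D" using D[of "z - s"] D[of "z + s"] by linarith
    moreover have "D \<ge> 0" using D[of 0] by linarith
    ultimately have "\<bar>?\<Phi> s\<bar> \<le> (2 * D) * (L / (pi * s))"
      unfolding abs_mult using cot_bounds_half[OF s] by (intro mult_mono) auto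
    then show ?thesis by simp
  qed
  have i1: "?\<Phi> integrable_on {0..\<delta>}" "?\<Phi> integrable_on {\<delta>..L/2}"
    by (rule integrable_subinterval_real[OF int]; use \<delta> in auto)+
  have "norm (integral {0..\<delta>} ?\<Phi>) \<le> 2 * M * L / pi * measure lborel {0..\<delta>}"
  proof (rule has_integral_bound_real[where S="{}", OF _ _ integrable_integral[OF i1(1)]])
    show "0 \<le> 2 * M * L / pi" using M0 L by simp
    show "norm (?\<Phi> s) \<le> 2 * M * L / pi" if "s \<in> {0..\<delta>} - {}" for s
      using near[of s] that by (simp only: real_norm_def) blast
  qed simp
  then have b1: "\<bar>integral {0..\<delta>} ?\<Phi>\<bar> \<le> 2 * M * L / pi * \<delta>"
    using \<delta> by simp
  have "((\<lambda>s. 2 * D * L / pi / s) has_integral 2 * D * L / pi * ln (L/2) - 2 * D * L / pi * ln \<delta>) {\<delta>..L/2}"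
    by (rule fundamental_theorem_of_calculus)
      (use \<delta> in \<open>auto intro!: derivative_eq_intros simp: has_real_derivative_iff_has_vector_derivative[symmetric] mult_ac\<close>)
  then have b2: "norm (integral {\<delta>..L/2} ?\<Phi>) \<le> 2 * D * L / pi * ln (L/2) - 2 * D * L / pi * ln \<delta>"
    using integral_norm_bound_integral[OF i1(2), of "\<lambda>s. 2 * D * L / pi / s"] far
    by (auto simp: has_integral_iff)
  have ln: "ln (L / (2 * \<delta>)) = ln (L/2) - ln \<delta>"
    using \<delta> L by (simp add: ln_div ln_mult)
  have "\<bar>integral {0..L/2} ?\<Phi>\<bar> = \<bar>integral {0..\<delta>} ?\<Phi> + integral {\<delta>..L/2} ?\<Phi>\<bar>"
    using Henstock_Kurzweil_Integration.integral_combine[OF _ _ int, of \<delta>] \<delta> by auto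
  also have "\<dots> \<le> 2 * M * L / pi * \<delta> + (2 * D * L / pi * ln (L/2) - 2 * D * L / pi * ln \<delta>)"
    using b1 b2 unfolding real_norm_def by (intro order_trans[OF abs_triangle_ineq] add_mono)
  also have "\<dots> = L * (2 / pi * (M * \<delta> + D * ln (L / (2 * \<delta>))))"
    unfolding ln by (simp add: field_simps)
  finally have "\<bar>integral {0..L/2} ?\<Phi>\<bar> \<le> L * (2 / pi * (M * \<delta> + D * ln (L / (2 * \<delta>))))" .
  then have "\<bar>integral {0..L/2} ?\<Phi>\<bar> / L \<le> 2 / pi * (M * \<delta> + D * ln (L / (2 * \<delta>)))"
    using L by (subst pos_divide_le_eq) (auto simp: mult.commute)
  then show ?thesis
    unfolding hilbert_sym_def using L by (simp add: abs_mult)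
qed

lemma cot_diff:
  fixes y z :: real
  assumes "sin (y - z) \<noteq> 0" "sin (y + z) \<noteq> 0"
  shows "cot (y - z) - cot (y + z) = sin (2 * z) / ((sin y)\<^sup>2 - (sin z)\<^sup>2)"
proof -
  have "sin (y - z) * sin (y + z) = (sin y)\<^sup>2 * (1 - (sin z)\<^sup>2) - (1 - (sin y)\<^sup>2) * (sin z)\<^sup>2"
    unfolding sin_add sin_diff cos_squared_eq[symmetric] by (simp add: power2_eq_square algebra_simps)
  then have e: "sin (y - z) * sin (y + z) = (sin y)\<^sup>2 - (sin z)\<^sup>2" by (simp add: algebra_simps)
  have "cos (y - z) * sin (y + z) - cos (y + z) * sin (y - z) = sin ((y + z) - (y - z))"
    unfolding sin_diff[of "y + z" "y - z"] by (simp add: mult.commute)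
  then show ?thesis using assms unfolding e[symmetric] by (simp add: cot_def field_simps)
qed

text \<open>Folding the symmetric integral of an even function onto half a period gives the kernel
  \<open>sin 2\<mu>z / (sin\<^sup>2 \<mu>y - sin\<^sup>2 \<mu>z)\<close>, which has the sign of \<open>y - z\<close>. For a function increasing
  on the half period everything is therefore nonnegative and the part \<open>y < z\<close> may be dropped.\<close>

lemma hilbert_even_lower_bound:
  assumes L: "L > 0" and per: "\<And>x. w (x + L) = w x" and even: "\<And>x. w (- x) = w x"
    and w': "\<And>x. (w has_real_derivative w' x) (at x)" and cw': "continuous_on UNIV w'"
    and mono: "\<And>x y. 0 \<le> x \<Longrightarrow> x \<le> y \<Longrightarrow> y \<le> L/2 \<Longrightarrow> w x \<le> w y"
    and z: "0 < z" "z < L / 2"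
  shows "- hilbert_sym L w z \<ge> sin (2 * (pi / L * z)) / L * integral {z..L/2} (\<lambda>y. (w y - w z) / (sin (pi / L * y))\<^sup>2)"
proof -
  define \<mu> where "\<mu> = pi / L"
  define B where "B y = (w y - w z) * cot (\<mu> * (y - z))" for y
  have cw: "continuous_on UNIV w" by (meson DERIV_isCont continuous_at_imp_continuous_on w')
  have Bper: "B (y + L) = B y" for y
  proof -
    have "y + L - z = y - z + L" by simp
    then show ?thesis using cot_diff_periodic[OF L, of "y - z"] per[of y] by (simp only: B_def \<mu>_def)
  qed
  have cm: "cot (- x) = - cot x" for x :: real by (simp add: cot_def)
  have i1: "(\<lambda>s. (w (z + s) - w z) * cot (\<mu> * s)) integrable_on {0..L/2}" unfolding \<mu>_def
    by (rule integrable_cot[OF L, where F'="\<lambda>s. w' (z + s)"])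
      (auto intro!: derivative_eq_intros DERIV_chain2[OF w'] continuous_intros continuous_on_compose2[OF cw'])
  have i2: "(\<lambda>s. (w z - w (z - s)) * cot (\<mu> * s)) integrable_on {0..L/2}" unfolding \<mu>_def
    by (rule integrable_cot[OF L, where F'="\<lambda>s. w' (z - s)"])
      (auto intro!: derivative_eq_intros DERIV_chain2[OF w'] continuous_intros continuous_on_compose2[OF cw'])
  define I1 where "I1 = integral {0..L/2} (\<lambda>s. (w (z + s) - w z) * cot (\<mu> * s))"
  define I2 where "I2 = integral {0..L/2} (\<lambda>s. (w z - w (z - s)) * cot (\<mu> * s))"
  have h1: "((\<lambda>s. (w (z + s) - w z) * cot (\<mu> * s)) has_integral I1) {0..L/2}"
    and h2: "((\<lambda>s. (w z - w (z - s)) * cot (\<mu> * s)) has_integral I2) {0..L/2}"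
    using i1 i2 by (auto simp: I1_def I2_def)
  have "((\<lambda>s. (w (z - s) - w (z + s)) * cot (\<mu> * s)) has_integral - (I1 + I2)) {0..L/2}"
    using has_integral_neg[OF has_integral_add[OF h1 h2]] by (simp add: algebra_simps)
  then have H: "- hilbert_sym L w z = 1 / L * (I1 + I2)"
    unfolding hilbert_sym_def \<mu>_def by (simp only: integral_unique minus_mult_right minus_minus)
  have "((\<lambda>s. B (s + z)) has_integral I1) {0..L/2}"
    using h1 by (simp add: B_def add.commute)
  from has_integral_shift_real_ivl[OF this, of "-z"]
  have r: "(B has_integral I1) {z..z + L/2}" by (simp add: add.commute)
  have "((\<lambda>s. B (- s + z)) has_integral I2) {0..L/2}"
    by (rule has_integral_eq[OF _ h2]) (simp add: B_def cm algebra_simps)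
  then have "((\<lambda>s. B (s + z)) has_integral I2) {-(L/2)..-0}"
    by (subst has_integral_reflect_real[symmetric]) simp
  from has_integral_shift_real_ivl[OF this, of "-z"]
  have l: "(B has_integral I2) {z - L/2..z}" by (simp add: add.commute)
  have "(B has_integral I2 + I1) {z - L/2..z + L/2}"
    by (rule has_integral_combine[OF _ _ l r]) (use L in auto)
  then have "(B has_integral I2 + I1) {z - L/2..z - L/2 + L}" by (simp add: field_simps)
  from has_integral_periodic[OF L Bper this, of "- (L/2)"]
  have B: "(B has_integral I2 + I1) {-(L/2)..L/2}" by (simp add: field_simps)
  have j1: "B integrable_on {-(L/2)..0}" and j2: "B integrable_on {0..L/2}"
    by (rule integrable_subinterval_real[OF has_integral_integrable[OF B]]; use L in auto)+
  have "((\<lambda>s. B (- s)) has_integral integral {-(L/2)..0} B) {0..L/2}"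
    using has_integral_reflect_lemma_real[OF integrable_integral[OF j1]] by simp
  from has_integral_add[OF integrable_integral[OF j2] this]
  have "((\<lambda>y. B y + B (- y)) has_integral integral {0..L/2} B + integral {-(L/2)..0} B) {0..L/2}" .
  moreover have "integral {0..L/2} B + integral {-(L/2)..0} B = I1 + I2"
    using Henstock_Kurzweil_Integration.integral_combine[of "-(L/2)" 0 "L/2" B] B L by (auto simp: has_integral_iff)
  ultimately have fold: "((\<lambda>y. B y + B (- y)) has_integral I1 + I2) {0..L/2}" by simp
  have s2z: "sin (2 * (\<mu> * z)) > 0"
    using sin_pos_half[of "2 * z" L] z by (simp add: \<mu>_def mult_ac)
  define R where "R y = (w y - w z) / (sin (\<mu> * y))\<^sup>2" for y
  have "sin (\<mu> * y) \<noteq> 0" if "y \<in> {z..L/2}" for y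
    using sin_pos_half[of y L] that z unfolding \<mu>_def by auto
  then have cR: "continuous_on {z..L/2} R" unfolding R_def
    by (intro continuous_intros continuous_on_subset[OF cw]) auto
  have "((\<lambda>y. if y \<in> {z..L/2} then sin (2 * (\<mu> * z)) * R y else 0) has_integral sin (2 * (\<mu> * z)) * integral {z..L/2} R) ({0..L/2})"
    using z by (subst has_integral_restrict) (auto intro!: has_integral_mult_right integrable_integral integrable_continuous_interval cR)
  moreover have "(if y \<in> {z..L/2} then sin (2 * (\<mu> * z)) * R y else 0) \<le> B y + B (- y)" if y: "y \<in> {0..L/2}" for y
  proof -
    have "cot (\<mu> * (- y - z)) = - cot (\<mu> * y + \<mu> * z)"
      using cm[of "\<mu> * y + \<mu> * z"] by (simp add: algebra_simps)
    then have BB: "B y + B (- y) = (w y - w z) * (cot (\<mu> * y - \<mu> * z) - cot (\<mu> * y + \<mu> * z))"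
      by (simp add: B_def even algebra_simps)
    have "sin (\<mu> * (y + z)) > 0" unfolding \<mu>_def by (rule sin_pos_half) (use y z in auto)
    then have sp: "sin (\<mu> * y + \<mu> * z) > 0" by (simp only: distrib_left)
    consider "y = z" | "y < z" | "y > z" by linarith
    then show ?thesis
    proof cases
      case 1 show ?thesis unfolding BB unfolding 1 by (simp add: R_def)
    next
      case 2
      have "sin (\<mu> * y) < sin (\<mu> * z)"
        unfolding \<mu>_def by (rule sin_half_mono) (use 2 y z in auto)
      moreover have "sin (\<mu> * y) \<ge> 0" using sin_pos_half[of y L] y L by (cases "y = 0") (auto simp: \<mu>_def)
      ultimately have "(sin (\<mu> * y))\<^sup>2 < (sin (\<mu> * z))\<^sup>2" by (intro power_strict_mono) auto
      moreover have "sin (\<mu> * (z - y)) > 0" unfolding \<mu>_def by (rule sin_pos_half) (use y z 2 in auto)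
      then have "sin (\<mu> * y - \<mu> * z) \<noteq> 0"
        using sin_minus[of "\<mu> * z - \<mu> * y"] by (simp add: right_diff_distrib)
      ultimately have "cot (\<mu> * y - \<mu> * z) - cot (\<mu> * y + \<mu> * z) \<le> 0"
        using s2z sp by (subst cot_diff) (auto intro!: divide_nonneg_neg)
      then have "B y + B (- y) \<ge> 0" unfolding BB using mono[of y z] 2 y z by (intro mult_nonpos_nonpos) auto
      then show ?thesis using 2 by simp
    next
      case 3
      have "sin (\<mu> * z) < sin (\<mu> * y)"
        unfolding \<mu>_def by (rule sin_half_mono) (use 3 y z in auto)
      moreover have sz: "sin (\<mu> * z) > 0" using sin_pos_half[of z L] z by (auto simp: \<mu>_def)
      ultimately have q: "(sin (\<mu> * z))\<^sup>2 < (sin (\<mu> * y))\<^sup>2" by (intro power_strict_mono) auto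
      have "sin (\<mu> * (y - z)) > 0" unfolding \<mu>_def by (rule sin_pos_half) (use y z 3 in auto)
      then have sy: "sin (\<mu> * y - \<mu> * z) \<noteq> 0" by (simp add: right_diff_distrib)
      have "sin (2 * (\<mu> * z)) / (sin (\<mu> * y))\<^sup>2 \<le> cot (\<mu> * y - \<mu> * z) - cot (\<mu> * y + \<mu> * z)"
        using sp s2z q sy sz by (subst cot_diff) (auto intro!: divide_left_mono mult_pos_pos)
      then have "(w y - w z) * (sin (2 * (\<mu> * z)) / (sin (\<mu> * y))\<^sup>2) \<le> B y + B (- y)"
        unfolding BB using mono[of z y] 3 y z by (intro mult_left_mono) auto
      then show ?thesis using 3 y by (simp add: R_def mult.commute)
    qed
  qed
  ultimately have "sin (2 * (\<mu> * z)) * integral {z..L/2} R \<le> I1 + I2"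
    by (rule has_integral_le[OF _ fold])
  then have "1 / L * (sin (2 * (\<mu> * z)) * integral {z..L/2} R) \<le> 1 / L * (I1 + I2)"
    using L by (intro mult_left_mono) auto
  then show ?thesis unfolding H by (simp add: R_def[abs_def] \<mu>_def)
qed

section \<open>Comparison principles and elementary calculus\<close>

text \<open>At the first time at which \<open>w\<close> ceases to be positive it has a minimum with value \<open>0\<close>, and its time derivative
  there cannot be positive. The space \<open>X\<close> is an arbitrary compact metric space so that several functions, or functions of
  two points, can be treated at once.\<close>

lemma first_touch:
  fixes w :: "'a::metric_space \<Rightarrow> real \<Rightarrow> real"
  assumes X: "compact X" and cont: "continuous_on (X \<times> {0..t1}) (\<lambda>(x, t). w x t)"
    and init: "\<And>x. x \<in> X \<Longrightarrow> w x 0 > 0"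
    and step: "\<And>x t. x \<in> X \<Longrightarrow> t \<in> {0<..t1} \<Longrightarrow> w x t = 0 \<Longrightarrow> (\<And>y. y \<in> X \<Longrightarrow> w y t \<ge> 0) \<Longrightarrow>
      \<exists>D>0. ((\<lambda>s. w x s) has_real_derivative D) (at t within {0..t1})"
    and x: "x \<in> X" and t: "t \<in> {0..t1}"
  shows "w x t > 0"
proof (rule ccontr)
  assume neg: "\<not> w x t > 0"
  let ?S = "X \<times> {0..t1}"
  define K where "K = ?S \<inter> (\<lambda>(x, t). w x t) -` {..0}"
  have cS: "compact ?S" using X by (intro compact_Times) auto
  have "closed K" unfolding K_def
    by (rule continuous_closed_preimage[OF cont]) (use cS compact_imp_closed in auto)
  then have "compact (?S \<inter> K)" by (rule compact_Int_closed[OF cS])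
  moreover have "?S \<inter> K = K" by (auto simp: K_def)
  ultimately have "compact K" by simp
  moreover have "(x, t) \<in> K" using neg x t by (auto simp: K_def)
  moreover have "continuous_on K snd" by (intro continuous_intros)
  ultimately obtain p where p: "p \<in> K" "\<And>q. q \<in> K \<Longrightarrow> snd p \<le> snd q"
    using continuous_attains_inf[of K snd] by blast
  obtain x0 t0 where p0: "p = (x0, t0)" by (cases p)
  have x0: "x0 \<in> X" and t0: "t0 \<in> {0..t1}" and w0: "w x0 t0 \<le> 0"
    using p(1) by (auto simp: p0 K_def)
  have "t0 \<noteq> 0" using init[OF x0] w0 by auto
  then have t0': "t0 > 0" using t0 by auto
  have before: "w y s > 0" if "y \<in> X" "0 \<le> s" "s < t0" for y s
    using p(2)[of "(y, s)"] that t0 by (force simp: p0 K_def)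
  have after: "w y t0 \<ge> 0" if y: "y \<in> X" for y
  proof (rule tendsto_lowerbound)
    have "continuous_on {0..t1} (\<lambda>s. w y s)"
      by (rule continuous_on_compose2[OF cont, where f="\<lambda>s. (y, s)", simplified])
        (use y in \<open>auto intro!: continuous_intros\<close>)
    then have "((\<lambda>s. w y s) \<longlongrightarrow> w y t0) (at t0 within {0..t1})"
      using t0 by (auto simp: continuous_on_def)
    then show "((\<lambda>s. w y s) \<longlongrightarrow> w y t0) (at_left t0)"
      by (rule tendsto_mono[rotated])
        (use t0 t0' in \<open>auto intro!: at_le simp: at_within_Icc_at_left[of 0 t0, symmetric]\<close>)
    show "\<forall>\<^sub>F s in at_left t0. 0 \<le> w y s"
      using eventually_at_left_real[OF t0'] by eventually_elim (use before[OF y] in \<open>auto intro: less_imp_le\<close>)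
  qed simp
  then have "w x0 t0 = 0" using w0 x0 by (simp add: antisym)
  then obtain D where D: "D > 0" "((\<lambda>s. w x0 s) has_real_derivative D) (at t0 within {0..t1})"
    using step[OF x0, of t0] after t0 t0' by auto
  from has_real_derivative_pos_inc_left[OF D(2,1)] obtain d where d: "d > 0"
    "\<And>h. h > 0 \<Longrightarrow> t0 - h \<in> {0..t1} \<Longrightarrow> h < d \<Longrightarrow> w x0 (t0 - h) < w x0 t0" by blast
  define h where "h = min (d/2) t0"
  have "w x0 (t0 - h) < w x0 t0" by (rule d(2)) (use d(1) t0 t0' in \<open>auto simp: h_def min_def\<close>)
  moreover have "w x0 (t0 - h) > 0" by (rule before[OF x0]) (use d(1) t0' in \<open>auto simp: h_def\<close>)
  ultimately show False using w0 by linarith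
qed

text \<open>The function \<open>w + \<epsilon> exp ((K + 1) t)\<close> satisfies the strict hypotheses of \<open>first_touch\<close>. In the applications
  the transport term vanishes at a spatial minimum, so only the zeroth order coefficient \<open>c\<close> remains.\<close>

lemma minimum_principle:
  fixes w :: "'a::metric_space \<Rightarrow> real \<Rightarrow> real"
  assumes X: "compact X" and cont: "continuous_on (X \<times> {0..t1}) (\<lambda>(x, t). w x t)"
    and init: "\<And>x. x \<in> X \<Longrightarrow> w x 0 \<ge> 0"
    and step: "\<And>x t. x \<in> X \<Longrightarrow> t \<in> {0<..t1} \<Longrightarrow> w x t < 0 \<Longrightarrow> (\<And>y. y \<in> X \<Longrightarrow> w y t \<ge> w x t) \<Longrightarrow>
      \<exists>D c. ((\<lambda>s. w x s) has_real_derivative D) (at t within {0..t1}) \<and> \<bar>c\<bar> \<le> K \<and> D \<ge> c * w x t"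
    and x: "x \<in> X" and t: "t \<in> {0..t1}"
  shows "w x t \<ge> 0"
proof -
  have "w x t + \<epsilon> * exp ((K + 1) * t) > 0" if \<epsilon>: "\<epsilon> > 0" for \<epsilon>
  proof (rule first_touch[OF X _ _ _ x t, where w="\<lambda>x t. w x t + \<epsilon> * exp ((K + 1) * t)"])
    show "continuous_on (X \<times> {0..t1}) (\<lambda>(x, t). w x t + \<epsilon> * exp ((K + 1) * t))"
      using cont unfolding split_beta by (intro continuous_intros)
    show "w y 0 + \<epsilon> * exp ((K + 1) * 0) > 0" if "y \<in> X" for y
      using init[OF that] \<epsilon> by auto
    fix y s assume y: "y \<in> X" and s: "s \<in> {0<..t1}" and zero: "w y s + \<epsilon> * exp ((K + 1) * s) = 0"
      and min: "\<And>z. z \<in> X \<Longrightarrow> 0 \<le> w z s + \<epsilon> * exp ((K + 1) * s)"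
    let ?e = "\<epsilon> * exp ((K + 1) * s)"
    have ws: "w y s = - ?e" and e: "?e > 0" using zero \<epsilon> by auto
    have "\<And>z. z \<in> X \<Longrightarrow> w z s \<ge> w y s" using min ws by force
    with step[OF y s] ws e obtain D c where D: "((\<lambda>s. w y s) has_real_derivative D) (at s within {0..t1})"
      "\<bar>c\<bar> \<le> K" "D \<ge> c * w y s" by auto
    have "(K + 1) * ?e + D > 0"
    proof -
      have "c * w y s \<ge> - (K * ?e)"
        unfolding ws using D(2) e mult_right_mono[of c K ?e] by (auto simp: abs_le_iff)
      then show ?thesis using D(3) e by (simp add: algebra_simps)
    qed
    moreover have "((\<lambda>s. w y s + \<epsilon> * exp ((K + 1) * s)) has_real_derivative (K + 1) * ?e + D) (at s within {0..t1})"
      by (auto intro!: derivative_eq_intros D(1))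
    ultimately show "\<exists>D>0. ((\<lambda>s. w y s + \<epsilon> * exp ((K + 1) * s)) has_real_derivative D) (at s within {0..t1})"
      by blast
  qed
  from this[of "\<epsilon> / exp ((K + 1) * t)" for \<epsilon>] have "w x t + \<epsilon> > 0" if "\<epsilon> > 0" for \<epsilon>
    using that by simp
  then show ?thesis by (meson field_le_epsilon less_imp_le)
qed

lemma antiderivative_real_line:
  fixes f :: "real \<Rightarrow> real"
  assumes "continuous_on UNIV f"
  obtains A where "\<And>x. (A has_real_derivative f x) (at x)" "A 0 = 0"
proof -
  define A where "A x = integral {0..x} f - integral {x..0} f" for x
  have "(A has_real_derivative f x) (at x)" for x
  proof -
    define a where "a = min x 0 - 1"
    define b where "b = max x 0 + 1"
    have c: "continuous_on S f" for S using assms continuous_on_subset by blast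
    have i: "f integrable_on {p..q}" for p q by (rule integrable_continuous_interval[OF c])
    have "((\<lambda>y. integral {a..y} f) has_real_derivative f x) (at x within {a..b})"
      by (rule integral_has_real_derivative[OF c]) (auto simp: a_def b_def)
    moreover have "x \<in> interior {a..b}" by (auto simp: a_def b_def)
    ultimately have "((\<lambda>y. integral {a..y} f) has_real_derivative f x) (at x)"
      by (metis at_within_interior)
    then have "((\<lambda>y. integral {a..y} f - integral {a..0} f) has_real_derivative f x) (at x)"
      by (auto intro!: derivative_eq_intros)
    then show ?thesis
    proof (rule has_field_derivative_transform_within_open)
      show "open {a<..}" "x \<in> {a<..}" by (auto simp: a_def)
      fix y assume y: "y \<in> {a<..}"
      have a0: "a < 0" by (auto simp: a_def)
      show "integral {a..y} f - integral {a..0} f = A y"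
      proof (cases "y \<ge> 0")
        case True
        have "integral {y..0} f = 0" using True by (cases "y = 0") auto
        then show ?thesis using Henstock_Kurzweil_Integration.integral_combine[OF _ _ i, of a 0 y] a0 True by (simp add: A_def)
      next
        case False
        then show ?thesis using Henstock_Kurzweil_Integration.integral_combine[OF _ _ i, of a y 0] y by (simp add: A_def)
      qed
    qed
  qed
  moreover have "A 0 = 0" by (simp add: A_def)
  ultimately show thesis by (rule that)
qed

text \<open>Averaging \<open>\<phi> z - \<phi> y\<close> over \<open>y\<close> gives \<open>\<phi> z\<close>.\<close>

lemma zero_mean_bound:
  fixes \<phi> \<phi>' :: "real \<Rightarrow> real"
  assumes L: "L > 0" and \<phi>': "\<And>x. (\<phi> has_real_derivative \<phi>' x) (at x)" and B: "\<And>x. \<bar>\<phi>' x\<bar> \<le> B"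
    and mean: "(\<phi> has_integral 0) {0..L}" and z: "z \<in> {0..L}"
  shows "\<bar>\<phi> z\<bar> \<le> B * L"
proof -
  have B0: "B \<ge> 0" using B[of 0] by linarith
  have "((\<lambda>y. \<phi> z - \<phi> y) has_integral (L * \<phi> z - 0)) {0..L}"
    using has_integral_diff[OF has_integral_const_real[of "\<phi> z" 0 L] mean] L by simp
  then have "norm (L * \<phi> z - 0) \<le> B * L * measure lborel {0..L}"
  proof (rule has_integral_bound_real[where S="{}", rotated 2])
    fix y assume "y \<in> {0..L} - {}"
    then have "\<bar>z - y\<bar> \<le> L" using z by auto
    moreover have "\<bar>\<phi> z - \<phi> y\<bar> \<le> B * \<bar>z - y\<bar>"
      using field_differentiable_bound[of UNIV \<phi> \<phi>' B z y] \<phi>' B by auto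
    ultimately show "norm (\<phi> z - \<phi> y) \<le> B * L" using B0 by (auto intro: order_trans mult_left_mono)
  qed (use B0 L in auto)
  then have "L * \<bar>\<phi> z\<bar> \<le> L * (B * L)" using L by (simp add: abs_mult mult_ac)
  then show ?thesis using L by simp
qed

text \<open>The functions \<open>F = 2 c tan (c t / 2)\<close> and \<open>G = c\<^sup>2 / cos\<^sup>2 (c t / 2)\<close> satisfy \<open>F' = G\<close> and \<open>G' = F G / 2\<close>.
  The system is cooperative: the smaller of \<open>f - F\<close> and \<open>g - G\<close> obeys a linear differential inequality as long as it is
  negative. This is the minimum principle on a space with two points.\<close>

lemma tan_comparison:
  fixes f g f' g' :: "real \<Rightarrow> real"
  assumes c: "c > 0" and t1: "c * t1 < pi"
    and f': "\<And>t. t \<in> {0..t1} \<Longrightarrow> (f has_real_derivative f' t) (at t within {0..t1})"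
    and g': "\<And>t. t \<in> {0..t1} \<Longrightarrow> (g has_real_derivative g' t) (at t within {0..t1})"
    and fg: "\<And>t. t \<in> {0..t1} \<Longrightarrow> f' t \<ge> g t"
    and gf: "\<And>t. t \<in> {0..t1} \<Longrightarrow> g' t \<ge> f t * g t / 2"
    and f0: "\<And>t. t \<in> {0..t1} \<Longrightarrow> f t \<ge> 0" and g0: "g 0 \<ge> c\<^sup>2"
    and t: "t \<in> {0..t1}"
  shows "f t \<ge> 2 * c * tan (c * t / 2)"
proof -
  define F where "F t = 2 * c * tan (c * t / 2)" for t
  define G where "G t = c\<^sup>2 * (inverse (cos (c * t / 2)))\<^sup>2" for t
  have cpos: "cos (c * t / 2) > 0" if "t \<in> {0..t1}" for t
  proof (rule cos_gt_zero_pi)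
    have "c * t \<le> c * t1" using that c by (intro mult_left_mono) auto
    then show "c * t / 2 < pi / 2" using t1 by linarith
    have "c * t \<ge> 0" using that c by auto
    then show "- (pi / 2) < c * t / 2" using pi_gt_zero by linarith
  qed
  have dF: "(F has_real_derivative G s) (at s within {0..t1})" if "s \<in> {0..t1}" for s
    unfolding F_def[abs_def] G_def using cpos[OF that]
    by (auto intro!: derivative_eq_intros simp: power2_eq_square)
  have dG: "(G has_real_derivative F s * G s / 2) (at s within {0..t1})" if "s \<in> {0..t1}" for s
    unfolding F_def G_def[abs_def] using cpos[OF that]
    by (auto intro!: derivative_eq_intros simp: power2_eq_square tan_def field_simps)
  have G0: "G s \<ge> 0" for s by (simp add: G_def)
  have cf: "continuous_on {0..t1} f" "continuous_on {0..t1} g" "continuous_on {0..t1} F" "continuous_on {0..t1} G"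
    by (rule DERIV_continuous_on, erule f' g' dF dG)+
  have "continuous_on {0..t1} (\<lambda>s. (f s + G s) / 2)" by (intro continuous_intros cf) auto
  then have "bounded ((\<lambda>s. (f s + G s) / 2) ` {0..t1})"
    by (intro compact_imp_bounded compact_continuous_image) auto
  then obtain K where "\<forall>y \<in> (\<lambda>s. (f s + G s) / 2) ` {0..t1}. norm y \<le> K"
    unfolding bounded_iff by blast
  then have K: "\<bar>(f s + G s) / 2\<bar> \<le> K" if "s \<in> {0..t1}" for s
    using that by (simp only: ball_simps real_norm_def)
  define w where "w x s = x * (f s - F s) + (1 - x) * (g s - G s)" for x s
  have "w 1 t \<ge> 0"
  proof (rule minimum_principle[where X="{0, 1::real}" and w=w and K="max 1 K"])
    show "continuous_on ({0, 1} \<times> {0..t1}) (\<lambda>(x, t). w x t)"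
      unfolding w_def split_beta
      by (intro continuous_intros cf[THEN continuous_on_compose2]) auto
    show "w x 0 \<ge> 0" if "x \<in> {0, 1}" for x
      using that f0[of 0] g0 t by (auto simp: w_def F_def G_def)
    fix x s assume x: "x \<in> {0, 1::real}" and "s \<in> {0<..t1}" and neg: "w x s < 0"
      and min: "\<And>y. y \<in> {0, 1} \<Longrightarrow> w y s \<ge> w x s"
    then have s: "s \<in> {0..t1}" by auto
    have d: "(w x has_real_derivative x * (f' s - G s) + (1 - x) * (g' s - F s * G s / 2)) (at s within {0..t1})"
      unfolding w_def[abs_def] by (auto intro!: derivative_eq_intros f'[OF s] g'[OF s] dF[OF s] dG[OF s])
    consider "x = 0" | "x = 1" using x by auto
    then show "\<exists>D c. (w x has_real_derivative D) (at s within {0..t1}) \<and> \<bar>c\<bar> \<le> max 1 K \<and> D \<ge> c * w x s"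
    proof cases
      case 1
      have "f s - F s \<ge> g s - G s" using min[of 1] 1 by (simp add: w_def)
      then have "G s * (f s - F s) \<ge> G s * (g s - G s)" using G0 by (intro mult_left_mono)
      then have "f s * g s / 2 - F s * G s / 2 \<ge> (f s + G s) / 2 * (g s - G s)"
        by (simp add: field_simps)
      then have "g' s - F s * G s / 2 \<ge> (f s + G s) / 2 * w x s"
        using gf[OF s] 1 by (simp add: w_def)
      then show ?thesis using d 1 K[OF s]
        by (intro exI[of _ "g' s - F s * G s / 2"] exI[of _ "(f s + G s) / 2"]) auto
    next
      case 2
      have "g s - G s \<ge> f s - F s" using min[of 0] 2 by (simp add: w_def)
      then have "f' s - G s \<ge> 1 * w x s" using fg[OF s] 2 by (simp add: w_def)
      then show ?thesis using d 2
        by (intro exI[of _ "f' s - G s"] exI[of _ 1]) auto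
    qed
  qed (use t in auto)
  then show ?thesis by (simp add: w_def F_def)
qed

section \<open>Smooth space-time functions and the velocity of a solution\<close>

lemma times_upto_interval: "t1 \<in> times_upto T \<Longrightarrow> {0..t1} \<subseteq> times_upto T"
  by (auto simp: times_upto_def intro: le_less_trans[of "ereal _" "ereal t1"])

lemma convex_times_upto: "convex (times_upto T)"
proof (rule is_interval_convex)
  show "is_interval (times_upto T)"
    unfolding is_interval_1 using times_upto_interval by (auto simp: times_upto_def) (meson ereal_less_eq(3) le_less_trans)
qed

lemma times_upto_nontrivial:
  assumes "t \<in> times_upto T"
  shows "at t within times_upto T \<noteq> bot"
proof -
  have "ereal t < T" using assms by (simp add: times_upto_def)
  then obtain r where r: "ereal t < r" "r < T" using dense by blast
  then obtain t' where t': "r = ereal t'" using assms by (cases r) (auto simp: times_upto_def)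
  have t: "t < t'" "0 \<le> t" "t' \<in> times_upto T" using r assms by (auto simp: t' times_upto_def)
  have "at t within {t..t'} \<le> at t within times_upto T"
    by (rule at_le) (use t times_upto_interval[OF t(3)] in auto)
  moreover have "at t within {t..t'} \<noteq> bot"
    using at_within_Icc_at_right[OF t(1)] trivial_limit_at_right_real by metis
  ultimately show ?thesis by (metis bot.extremum_uniqueI)
qed

lemma smooth_dz: "smooth_spacetime T f \<Longrightarrow> smooth_spacetime T (dz f)"
  unfolding smooth_spacetime_def by (metis Ck_spacetime.simps(2))

lemma smooth_dt: "smooth_spacetime T f \<Longrightarrow> smooth_spacetime T (dt T f)"
  unfolding smooth_spacetime_def by (metis Ck_spacetime.simps(2))

lemma smooth_continuous: "smooth_spacetime T f \<Longrightarrow> continuous_on (UNIV \<times> times_upto T) (\<lambda>(z, t). f z t)"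
  unfolding smooth_spacetime_def by (metis Ck_spacetime.simps(1))

lemma smooth_deriv_z:
  assumes "smooth_spacetime T f" "t \<in> times_upto T"
  shows "((\<lambda>x. f x t) has_real_derivative dz f z t) (at z)"
proof -
  have "Ck_spacetime T (Suc 0) f" using assms unfolding smooth_spacetime_def by blast
  then have "(\<lambda>x. f x t) differentiable (at z)" using assms by simp
  then show ?thesis unfolding dz_def by (simp add: DERIV_deriv_iff_real_differentiable)
qed

lemma smooth_deriv_t:
  assumes "smooth_spacetime T f" "t \<in> times_upto T"
  shows "((\<lambda>s. f z s) has_real_derivative dt T f z t) (at t within times_upto T)"
proof -
  have "Ck_spacetime T (Suc 0) f" using assms unfolding smooth_spacetime_def by blast
  then have "(\<lambda>s. f z s) differentiable (at t within times_upto T)" using assms by simp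
  then show ?thesis unfolding dt_def
    by (simp add: vector_derivative_works has_real_derivative_iff_has_vector_derivative)
qed

lemma smooth_continuous_z:
  assumes "smooth_spacetime T f" "t \<in> times_upto T"
  shows "continuous_on S (\<lambda>z. f z t)"
  by (rule continuous_on_compose2[OF smooth_continuous[OF assms(1)], where f="\<lambda>z. (z, t)", simplified])
    (use assms in \<open>auto intro!: continuous_intros\<close>)

text \<open>Differentiating \<open>f y t - f a t = \<integral> f_z\<close> in time under the integral sign yields \<open>f_t y t - f_t a t = \<integral> (f_z)_t\<close>,
  and the right-hand side can be differentiated in \<open>y\<close>.\<close>

lemma smooth_mixed_partials:
  assumes f: "smooth_spacetime T f" and t: "t \<in> times_upto T"
  shows "dz (dt T f) z t = dt T (dz f) z t"
proof -
  let ?h = "dt T (dz f)"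
  note h = smooth_dt[OF smooth_dz[OF f]]
  define a where "a = z - 1"
  have eq: "dt T f y t = dt T f a t + integral {a..y} (\<lambda>x. ?h x t)" if y: "y \<ge> a" for y
  proof -
    have ftc: "integral {a..y} (\<lambda>x. dz f x s) = f y s - f a s" if s: "s \<in> times_upto T" for s
      by (rule integral_unique, rule fundamental_theorem_of_calculus[OF y])
        (use smooth_deriv_z[OF f s] in \<open>auto simp: has_real_derivative_iff_has_vector_derivative
          intro: has_vector_derivative_at_within\<close>)
    have "((\<lambda>s. integral (cbox a y) (\<lambda>x. dz f x s)) has_field_derivative integral (cbox a y) ((\<lambda>s x. ?h x s) t)) (at t within times_upto T)"
    proof (rule leibniz_rule_field_derivative[OF _ _ _ t convex_times_upto])
      show "((\<lambda>s. dz f x s) has_field_derivative ?h x s) (at s within times_upto T)"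
        if "s \<in> times_upto T" for s x by (rule smooth_deriv_t[OF smooth_dz[OF f] that])
      show "(\<lambda>x. dz f x s) integrable_on cbox a y" if "s \<in> times_upto T" for s
        using smooth_continuous_z[OF smooth_dz[OF f] that] by (intro integrable_continuous) auto
      show "continuous_on (times_upto T \<times> cbox a y) (\<lambda>(s, x). ?h x s)"
        using continuous_on_compose2[OF smooth_continuous[OF h], of "times_upto T \<times> cbox a y" "\<lambda>x. (snd x, fst x)"]
        by (simp add: split_beta continuous_intros image_subset_iff mem_Times_iff)
    qed
    then have "((\<lambda>s. integral {a..y} (\<lambda>x. dz f x s)) has_field_derivative integral {a..y} (\<lambda>x. ?h x t)) (at t within times_upto T)"
      by (simp only: cbox_interval)
    then have "((\<lambda>s. f y s - f a s) has_field_derivative integral {a..y} (\<lambda>x. ?h x t)) (at t within times_upto T)"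
      by (rule has_field_derivative_transform_within[OF _ zero_less_one t]) (simp add: ftc)
    moreover have "((\<lambda>s. f y s - f a s) has_field_derivative dt T f y t - dt T f a t) (at t within times_upto T)"
      by (intro derivative_intros smooth_deriv_t f t)
    ultimately have "integral {a..y} (\<lambda>x. ?h x t) = dt T f y t - dt T f a t"
      using vector_derivative_unique_within[OF times_upto_nontrivial[OF t]]
      unfolding has_real_derivative_iff_has_vector_derivative by blast
    then show ?thesis by simp
  qed
  have "((\<lambda>y. integral {a..y} (\<lambda>x. ?h x t)) has_real_derivative ?h z t) (at z within {a..z + 1})"
    by (rule integral_has_real_derivative[OF smooth_continuous_z[OF h t]]) (auto simp: a_def)
  moreover have "z \<in> interior {a..z + 1}" by (auto simp: a_def)
  ultimately have "((\<lambda>y. integral {a..y} (\<lambda>x. ?h x t)) has_real_derivative ?h z t) (at z)"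
    by (metis at_within_interior)
  from DERIV_add[OF DERIV_const[of "dt T f a t"] this]
  have "((\<lambda>y. dt T f a t + integral {a..y} (\<lambda>x. ?h x t)) has_real_derivative ?h z t) (at z)"
    by (simp only: add_0)
  then have "((\<lambda>y. dt T f y t) has_real_derivative ?h z t) (at z)"
  proof (rule has_field_derivative_transform_within_open[of _ _ _ "{a<..}"])
    show "z \<in> {a<..}" by (simp add: a_def)
    show "dt T f a t + integral {a..y} (\<lambda>x. ?h x t) = dt T f y t" if "y \<in> {a<..}" for y
      using eq[of y] that by simp
  qed simp
  then show ?thesis
    using smooth_deriv_z[OF smooth_dt[OF f] t] DERIV_unique by blast
qed

lemma periodic_dz:
  assumes f: "smooth_spacetime T f" and t: "t \<in> times_upto T" and per: "\<And>z. f (z + L) t = f z t"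
  shows "dz f (z + L) t = dz f z t"
proof -
  have "((\<lambda>x. f (x + L) t) has_real_derivative dz f (z + L) t) (at z)"
    using smooth_deriv_z[OF f t, of "z + L"] by (simp add: DERIV_shift)
  then show ?thesis using smooth_deriv_z[OF f t, of z] DERIV_unique unfolding per by blast
qed

lemma periodic_reduce:
  fixes L z :: real
  assumes "L > 0"
  obtains k :: int where "z + of_int k * L \<in> {0..L}"
proof
  show "z + of_int (- \<lfloor>z / L\<rfloor>) * L \<in> {0..L}"
    using floor_divide_lower[OF assms, of z] floor_divide_upper[OF assms, of z] by (auto simp: algebra_simps)
qed

lemma periodic_smooth_bounded:
  assumes L: "L > 0" and f: "smooth_spacetime T f" and t1: "t1 \<in> times_upto T"
    and per: "\<And>z t. t \<in> times_upto T \<Longrightarrow> f (z + L) t = f z t"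
  obtains M where "\<And>z t. t \<in> {0..t1} \<Longrightarrow> \<bar>f z t\<bar> \<le> M"
proof -
  have "continuous_on ({0..L} \<times> {0..t1}) (\<lambda>(z, t). f z t)"
    by (rule continuous_on_subset[OF smooth_continuous[OF f]]) (use times_upto_interval[OF t1] in auto)
  then have "bounded ((\<lambda>(z, t). f z t) ` ({0..L} \<times> {0..t1}))"
    by (intro compact_imp_bounded compact_continuous_image compact_Times) auto
  then obtain M where M: "\<And>z t. z \<in> {0..L} \<Longrightarrow> t \<in> {0..t1} \<Longrightarrow> \<bar>f z t\<bar> \<le> M"
    unfolding bounded_iff by fastforce
  show ?thesis
  proof
    fix z t assume t: "t \<in> {0..t1}"
    obtain k :: int where k: "z + of_int k * L \<in> {0..L}" using periodic_reduce[OF L] .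
    have "f (z + of_int k * L) t = f z t"
      by (rule periodic_shift_int[where f="\<lambda>z. f z t"]) (use per t times_upto_interval[OF t1] in auto)
    then show "\<bar>f z t\<bar> \<le> M" using M[OF k t] by simp
  qed
qed

locale model_solution =
  fixes L a :: real and T :: ereal and u \<omega> v :: "real \<Rightarrow> real \<Rightarrow> real"
  assumes L: "L > 0" and a: "a > 0"
    and sol: "smooth_solution L T u \<omega> v"
    and u_init: "\<And>z. u z 0 = a * (sin (pi / L * z))\<^sup>2"
    and \<omega>_init: "\<And>z. \<omega> z 0 = 0"
begin

abbreviation "I \<equiv> times_upto T"

definition v_z :: "real \<Rightarrow> real \<Rightarrow> real" where "v_z z t = hilbert_sym L (\<lambda>x. \<omega> x t) z"
definition v_zz :: "real \<Rightarrow> real \<Rightarrow> real" where "v_zz z t = hilbert_sym L (\<lambda>x. dz \<omega> x t) z"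

lemma u_smooth: "smooth_spacetime T u" and \<omega>_smooth: "smooth_spacetime T \<omega>"
  using sol by (auto simp: smooth_solution_def)

lemma u_periodic: "t \<in> I \<Longrightarrow> u (z + L) t = u z t"
  and \<omega>_periodic: "t \<in> I \<Longrightarrow> \<omega> (z + L) t = \<omega> z t"
  and v_periodic: "t \<in> I \<Longrightarrow> v (z + L) t = v z t"
  and v_mean: "t \<in> I \<Longrightarrow> integral {0..L} (\<lambda>z. v z t) = 0"
  using sol unfolding smooth_solution_def is_velocity_def by blast+

lemma u_eq: "t \<in> I \<Longrightarrow> dt T u z t = - (v z t * dz u z t)"
  and \<omega>_eq: "t \<in> I \<Longrightarrow> dt T \<omega> z t = dz u z t - v z t * dz \<omega> z t"
  using sol unfolding smooth_solution_def eq_neg_iff_add_eq_0 eq_diff_eq by blast+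

lemmas u_z_deriv = smooth_deriv_z[OF smooth_dz[OF u_smooth]]
lemmas \<omega>_deriv = smooth_deriv_z[OF \<omega>_smooth]
lemmas \<omega>_z_deriv = smooth_deriv_z[OF smooth_dz[OF \<omega>_smooth]]

lemma v_deriv: "t \<in> I \<Longrightarrow> ((\<lambda>z. v z t) has_real_derivative v_z z t) (at z)"
proof -
  assume t: "t \<in> I"
  have "hilbert L (\<lambda>x. \<omega> x t) z = v_z z t" unfolding v_z_def
    by (rule hilbert_eq_sym[OF L]) (use t in \<open>auto intro!: \<omega>_periodic \<omega>_deriv smooth_continuous_z[OF smooth_dz[OF \<omega>_smooth]]\<close>)
  then show ?thesis using sol t unfolding smooth_solution_def is_velocity_def by metis
qed

lemma v_z_deriv: "t \<in> I \<Longrightarrow> ((\<lambda>z. v_z z t) has_real_derivative v_zz z t) (at z)"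
  unfolding v_z_def v_zz_def
  by (rule hilbert_sym_deriv[OF L]) (auto intro!: \<omega>_deriv \<omega>_z_deriv smooth_continuous_z smooth_dz \<omega>_smooth)

lemma dz_v: "t \<in> I \<Longrightarrow> dz v z t = v_z z t"
  unfolding dz_def by (rule DERIV_imp_deriv[OF v_deriv])

lemma dz_dz_v: "t \<in> I \<Longrightarrow> dz (dz v) z t = v_zz z t"
  unfolding dz_def[of "dz v"] by (subst dz_v) (auto intro!: DERIV_imp_deriv[OF v_z_deriv])

lemma u_z_eq: "t \<in> I \<Longrightarrow> dt T (dz u) z t = - (v_z z t * dz u z t + v z t * dz (dz u) z t)"
proof -
  assume t: "t \<in> I"
  have "((\<lambda>z. - (v z t * dz u z t)) has_real_derivative - (v_z z t * dz u z t + v z t * dz (dz u) z t)) (at z)"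
    by (auto intro!: derivative_eq_intros v_deriv[OF t] u_z_deriv[OF t])
  then have "((\<lambda>z. dt T u z t) has_real_derivative - (v_z z t * dz u z t + v z t * dz (dz u) z t)) (at z)"
    by (simp add: u_eq[OF t])
  then have "dz (dt T u) z t = - (v_z z t * dz u z t + v z t * dz (dz u) z t)"
    unfolding dz_def[of "dt T u"] by (rule DERIV_imp_deriv)
  then show ?thesis using smooth_mixed_partials[OF u_smooth t] by simp
qed

lemma deriv_t_within:
  assumes "smooth_spacetime T f" "t1 \<in> I" "t \<in> {0..t1}"
  shows "((\<lambda>s. f z s) has_real_derivative dt T f z t) (at t within {0..t1})"
  by (rule DERIV_subset[OF smooth_deriv_t[OF assms(1)]]) (use times_upto_interval[OF assms(2)] assms(3) in auto)

lemma v_z_bounded: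
  assumes t1: "t1 \<in> I"
  obtains M where "\<And>z t. t \<in> {0..t1} \<Longrightarrow> \<bar>v_z z t\<bar> \<le> M"
proof -
  obtain M where M: "\<And>z t. t \<in> {0..t1} \<Longrightarrow> \<bar>dz \<omega> z t\<bar> \<le> M"
    by (rule periodic_smooth_bounded[OF L smooth_dz[OF \<omega>_smooth] t1]) (auto intro: periodic_dz \<omega>_smooth \<omega>_periodic)
  obtain D where D: "\<And>z t. t \<in> {0..t1} \<Longrightarrow> \<bar>\<omega> z t\<bar> \<le> D"
    by (rule periodic_smooth_bounded[OF L \<omega>_smooth t1]) (auto intro: \<omega>_periodic)
  show ?thesis
  proof
    fix z t assume t: "t \<in> {0..t1}"
    then have tI: "t \<in> I" using times_upto_interval[OF t1] by auto
    show "\<bar>v_z z t\<bar> \<le> 2 / pi * (M * (L/2) + D * ln (L / (2 * (L/2))))"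
      unfolding v_z_def
      by (rule hilbert_sym_bound[OF L, where w'="\<lambda>x. dz \<omega> x t"])
        (use t tI L M D in \<open>auto intro!: \<omega>_deriv smooth_continuous_z smooth_dz \<omega>_smooth\<close>)
  qed
qed

end

section \<open>Symmetry of the solution\<close>

lemma hilbert_sym_reflect: "hilbert_sym L w (- z) = - hilbert_sym L (\<lambda>x. w (- x)) z"
proof -
  have *: "- (z - s) = - z + s" "- (z + s) = - z - s" for s by simp_all
  have "(\<lambda>s. (w (- z - s) - w (- z + s)) * cot (pi / L * s)) = (\<lambda>s. - ((w (- (z - s)) - w (- (z + s))) * cot (pi / L * s)))"
    unfolding * by (simp add: algebra_simps)
  then show ?thesis unfolding hilbert_sym_def by (simp only: integral_neg mult_minus_right)
qed

lemma hilbert_sym_add: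
  assumes L: "L > 0"
    and f: "\<And>x. (f has_real_derivative f' x) (at x)" "continuous_on UNIV f'"
    and g: "\<And>x. (g has_real_derivative g' x) (at x)" "continuous_on UNIV g'"
  shows "hilbert_sym L (\<lambda>x. f x + g x) z = hilbert_sym L f z + hilbert_sym L g z"
proof -
  have "(\<lambda>s. (f (z - s) + g (z - s) - (f (z + s) + g (z + s))) * cot (pi / L * s)) =
    (\<lambda>s. (f (z - s) - f (z + s)) * cot (pi / L * s) + (g (z - s) - g (z + s)) * cot (pi / L * s))"
    by (auto simp: algebra_simps)
  then show ?thesis unfolding hilbert_sym_def
    by (simp only: Henstock_Kurzweil_Integration.integral_add[OF integrable_hilbert_sym[OF L f] integrable_hilbert_sym[OF L g]] distrib_left)
qed

lemma nonpos_if_below_all_exp: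
  fixes y c N0 :: real
  assumes "c > 0" "\<And>N. N \<ge> N0 \<Longrightarrow> y \<le> exp (- (N * c))"
  shows "y \<le> 0"
proof (rule ccontr)
  assume "\<not> y \<le> 0"
  define N where "N = max N0 ((1 - ln y) / c)"
  have "(1 - ln y) / c \<le> N" by (simp add: N_def)
  then have "1 - ln y \<le> N * c" using assms(1) by (simp add: field_simps)
  then have "exp (- (N * c)) \<le> exp (ln y - 1)" by simp
  also have "\<dots> < exp (ln y)" by simp
  finally have "exp (- (N * c)) < y" using \<open>\<not> y \<le> 0\<close> by simp
  then show False using assms(2)[of N] by (simp add: N_def)
qed

context model_solution
begin

definition \<omega>_even :: "real \<Rightarrow> real \<Rightarrow> real" where "\<omega>_even z t = \<omega> z t + \<omega> (- z) t"
definition u_z_even :: "real \<Rightarrow> real \<Rightarrow> real" where "u_z_even z t = dz u z t + dz u (- z) t"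
definition v_even :: "real \<Rightarrow> real \<Rightarrow> real" where "v_even z t = v z t + v (- z) t"

lemma \<omega>_even_deriv:
  "t \<in> I \<Longrightarrow> ((\<lambda>z. \<omega>_even z t) has_real_derivative dz \<omega> z t - dz \<omega> (- z) t) (at z)"
  unfolding \<omega>_even_def
  using DERIV_chain2[OF \<omega>_deriv DERIV_minus[OF DERIV_ident], of t z] by (auto intro!: derivative_eq_intros \<omega>_deriv)

lemma u_z_even_deriv:
  "t \<in> I \<Longrightarrow> ((\<lambda>z. u_z_even z t) has_real_derivative dz (dz u) z t - dz (dz u) (- z) t) (at z)"
  unfolding u_z_even_def
  using DERIV_chain2[OF u_z_deriv DERIV_minus[OF DERIV_ident], of t z] by (auto intro!: derivative_eq_intros u_z_deriv)

lemma v_even_deriv: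
  "t \<in> I \<Longrightarrow> ((\<lambda>z. v_even z t) has_real_derivative v_z z t - v_z (- z) t) (at z)"
  unfolding v_even_def
  using DERIV_chain2[OF v_deriv DERIV_minus[OF DERIV_ident], of t z] by (auto intro!: derivative_eq_intros v_deriv)

lemma v_z_odd_part:
  assumes t: "t \<in> I"
  shows "v_z z t - v_z (- z) t = hilbert_sym L (\<lambda>x. \<omega>_even x t) z"
proof -
  have "((\<lambda>x. \<omega> (- x) t) has_real_derivative - dz \<omega> (- x) t) (at x)" for x
    using DERIV_chain2[OF \<omega>_deriv[OF t] DERIV_minus[OF DERIV_ident], of x] by simp
  moreover have "continuous_on UNIV (\<lambda>x. - dz \<omega> (- x) t)"
    by (intro continuous_intros continuous_on_compose2[OF smooth_continuous_z[OF smooth_dz[OF \<omega>_smooth] t, of UNIV]]) auto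
  ultimately have "hilbert_sym L (\<lambda>x. \<omega> x t + \<omega> (- x) t) z = hilbert_sym L (\<lambda>x. \<omega> x t) z + hilbert_sym L (\<lambda>x. \<omega> (- x) t) z"
    by (rule hilbert_sym_add[OF L \<omega>_deriv[OF t] smooth_continuous_z[OF smooth_dz[OF \<omega>_smooth] t]])
  then show ?thesis
    unfolding v_z_def \<omega>_even_def hilbert_sym_reflect[of L _ z] by simp
qed

lemma v_even_mean:
  assumes t: "t \<in> I"
  shows "((\<lambda>z. v_even z t) has_integral 0) {0..L}"
proof -
  have "continuous_on {0..L} (\<lambda>z. v z t)"
    by (rule DERIV_continuous_on, rule DERIV_subset[OF v_deriv[OF t]]) simp
  then have i: "((\<lambda>z. v z t) has_integral 0) {0..L}"
    using v_mean[OF t] integrable_continuous_interval by (metis integrable_integral)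
  then have "((\<lambda>z. v z t) has_integral 0) {-L..-L + L}"
    using has_integral_periodic[OF L, of "\<lambda>z. v z t" 0 0 "-L"] v_periodic[OF t] by simp
  then have "((\<lambda>z. v (- z) t) has_integral 0) {0..L}"
    using has_integral_reflect_lemma_real[of "\<lambda>z. v z t" 0 "-L" 0] by simp
  from has_integral_add[OF i this] show ?thesis by (simp add: v_even_def)
qed

text \<open>This is \<open>hilbert_sym_bound\<close> with \<open>\<delta> = \<psi> L / 2\<close>, which turns the logarithm into \<open>ln (1 / \<psi>)\<close>.\<close>

lemma v_even_bound:
  assumes t: "t \<in> I" and M: "\<And>z. \<bar>dz \<omega> z t\<bar> \<le> M" and \<psi>: "0 < \<psi>" "\<psi> < 1" and b: "\<And>x. \<bar>\<omega>_even x t\<bar> \<le> \<psi>"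
  defines "B \<equiv> 2 / pi * (2 * M * (\<psi> * (L/2)) + \<psi> * ln (1 / \<psi>))"
  shows "\<bar>v_z z t - v_z (- z) t\<bar> \<le> B" and "z \<in> {0..L} \<Longrightarrow> \<bar>v_even z t\<bar> \<le> B * L"
proof -
  have "L / (2 * (\<psi> * (L/2))) = 1 / \<psi>" using L by (simp add: field_simps)
  moreover have "\<bar>hilbert_sym L (\<lambda>x. \<omega>_even x t) z\<bar> \<le> 2 / pi * (2 * M * (\<psi> * (L/2)) + \<psi> * ln (L / (2 * (\<psi> * (L/2)))))" for z
  proof (rule hilbert_sym_bound[OF L \<omega>_even_deriv[OF t]])
    have "continuous_on UNIV (\<lambda>x. dz \<omega> x t)" by (rule smooth_continuous_z[OF smooth_dz[OF \<omega>_smooth] t])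
    then show "continuous_on UNIV (\<lambda>x. dz \<omega> x t - dz \<omega> (- x) t)"
      by (intro continuous_intros continuous_on_compose2[where f="\<lambda>x. - x"]) auto
    show "\<bar>dz \<omega> x t - dz \<omega> (- x) t\<bar> \<le> 2 * M" for x using M[of x] M[of "- x"] by linarith
  qed (use b \<psi> L in auto)
  ultimately show 1: "\<bar>v_z z t - v_z (- z) t\<bar> \<le> B" for z
    unfolding v_z_odd_part[OF t] B_def by simp
  show "z \<in> {0..L} \<Longrightarrow> \<bar>v_even z t\<bar> \<le> B * L"
    by (rule zero_mean_bound[OF L v_even_deriv[OF t] 1 v_even_mean[OF t]])
qed

text \<open>This equation and the next one form a linear transport system along \<open>v\<close> for the even parts of \<open>\<omega>\<close> and \<open>u_z\<close>.
  Using \<open>u_z\<close> rather than \<open>u\<close> avoids a loss of derivatives.\<close>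

lemma \<omega>_even_deriv_t:
  assumes t1: "t1 \<in> I" and t: "t \<in> {0..t1}"
  shows "((\<lambda>s. \<omega>_even z s) has_real_derivative
    u_z_even z t - v z t * (dz \<omega> z t - dz \<omega> (- z) t) - v_even z t * dz \<omega> (- z) t) (at t within {0..t1})"
proof -
  have tI: "t \<in> I" using t times_upto_interval[OF t1] by auto
  have "((\<lambda>s. \<omega>_even z s) has_real_derivative dt T \<omega> z t + dt T \<omega> (- z) t) (at t within {0..t1})"
    unfolding \<omega>_even_def by (intro DERIV_add deriv_t_within[OF \<omega>_smooth t1 t])
  then show ?thesis unfolding \<omega>_eq[OF tI] by (simp add: u_z_even_def v_even_def algebra_simps)
qed

lemma u_z_even_deriv_t:
  assumes t1: "t1 \<in> I" and t: "t \<in> {0..t1}"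
  shows "((\<lambda>s. u_z_even z s) has_real_derivative
    - v z t * (dz (dz u) z t - dz (dz u) (- z) t) - v_even z t * dz (dz u) (- z) t
    - v_z z t * u_z_even z t + (v_z z t - v_z (- z) t) * dz u (- z) t) (at t within {0..t1})"
proof -
  have tI: "t \<in> I" using t times_upto_interval[OF t1] by auto
  have "((\<lambda>s. u_z_even z s) has_real_derivative dt T (dz u) z t + dt T (dz u) (- z) t) (at t within {0..t1})"
    unfolding u_z_even_def by (intro DERIV_add deriv_t_within[OF smooth_dz[OF u_smooth] t1 t])
  then show ?thesis unfolding u_z_eq[OF tI] by (simp add: u_z_even_def v_even_def algebra_simps)
qed

lemma u_z_init: "dz u z 0 = a * (pi / L) * sin (2 * (pi / L * z))"
proof -
  have "((\<lambda>x. u x 0) has_real_derivative a * (2 * (sin (pi / L * z) * (cos (pi / L * z) * (pi / L))))) (at z)"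
    unfolding u_init using L by (auto intro!: derivative_eq_intros)
  then have "dz u z 0 = a * (2 * (sin (pi / L * z) * (cos (pi / L * z) * (pi / L))))"
    unfolding dz_def by (rule DERIV_imp_deriv)
  then show ?thesis unfolding sin_double by simp
qed

lemma u_z_periodic: "t \<in> I \<Longrightarrow> dz u (z + L) t = dz u z t"
  by (rule periodic_dz[OF u_smooth]) (auto intro: u_periodic)

lemma even_periodic:
  assumes t: "t \<in> I"
  shows "\<omega>_even (y + L) t = \<omega>_even y t" "u_z_even (y + L) t = u_z_even y t"
  using \<omega>_periodic[OF t, of "- y - L"] \<omega>_periodic[OF t, of y] u_z_periodic[OF t, of "- y - L"] u_z_periodic[OF t, of y]
  by (simp_all add: \<omega>_even_def u_z_even_def)

text \<open>With \<open>l = N e\<^sup>-\<^sup>A\<^sup>t \<ge> 1\<close> and \<open>\<psi> = e\<^sup>-\<^sup>l\<close>, the barrier grows at the rate \<open>A l \<psi> = A \<psi> ln (1/\<psi>)\<close>, while even parts of size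
  \<open>\<psi>\<close> drive the system at a rate of at most a constant times \<open>\<psi> (1 + l)\<close>. For large \<open>A\<close> they can
  therefore never reach the barrier, and \<open>\<psi>\<close> tends to \<open>0\<close> as \<open>N\<close> grows.\<close>

lemma even_parts_vanish:
  assumes t1: "t1 \<in> I" and z: "z \<in> {0..L}"
  shows "\<omega>_even z t1 = 0" "u_z_even z t1 = 0"
proof -
  have t1_0: "t1 \<ge> 0" using t1 by (simp add: times_upto_def)
  have tI: "t \<in> I" if "t \<in> {0..t1}" for t using that times_upto_interval[OF t1] by auto
  obtain M1 where M1: "\<And>z t. t \<in> {0..t1} \<Longrightarrow> \<bar>dz \<omega> z t\<bar> \<le> M1"
    by (rule periodic_smooth_bounded[OF L smooth_dz[OF \<omega>_smooth] t1]) (auto intro: periodic_dz \<omega>_smooth \<omega>_periodic)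
  obtain M2 where M2: "\<And>z t. t \<in> {0..t1} \<Longrightarrow> \<bar>dz u z t\<bar> \<le> M2"
    by (rule periodic_smooth_bounded[OF L smooth_dz[OF u_smooth] t1]) (auto intro: periodic_dz u_smooth u_periodic)
  obtain M3 where M3: "\<And>z t. t \<in> {0..t1} \<Longrightarrow> \<bar>dz (dz u) z t\<bar> \<le> M3"
    by (rule periodic_smooth_bounded[OF L smooth_dz[OF smooth_dz[OF u_smooth]] t1])
      (auto intro: periodic_dz smooth_dz u_smooth u_periodic)
  obtain K where K: "\<And>z t. t \<in> {0..t1} \<Longrightarrow> \<bar>v_z z t\<bar> \<le> K" using v_z_bounded[OF t1] by blast
  define M where "M = max M1 (max M2 M3)"
  have M: "\<bar>dz \<omega> z t\<bar> \<le> M" "\<bar>dz u z t\<bar> \<le> M" "\<bar>dz (dz u) z t\<bar> \<le> M" if "t \<in> {0..t1}" for z t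
    using M1[OF that, of z] M2[OF that, of z] M3[OF that, of z] by (simp_all add: M_def le_max_iff_disj)
  have M0: "M \<ge> 0" using M(1)[of 0 0] t1_0 by force
  have K0: "K \<ge> 0" using K[of 0 0] t1_0 by force
  define A where "A = 2 + K + (M * L + 1) * (M * (L + 1))"
  have "\<bar>\<omega>_even z t1\<bar> \<le> exp (- (N * exp (- A * t1))) \<and> \<bar>u_z_even z t1\<bar> \<le> exp (- (N * exp (- A * t1)))" if N: "N \<ge> exp (A * t1)" for N
  proof -
    have A0: "A > 0" using M0 K0 L by (simp add: A_def add_pos_nonneg)
    define l where "l t = N * exp (- A * t)" for t
    define \<psi> where "\<psi> t = exp (- l t)" for t
    have l1: "l t \<ge> 1" if "t \<in> {0..t1}" for t
    proof -
      have "A * t \<le> A * t1" using that A0 by (intro mult_left_mono) auto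
      then have "exp (A * t) \<le> N" using N by (meson exp_le_cancel_iff order_trans)
      then show ?thesis by (simp add: l_def exp_minus field_simps)
    qed
    have \<psi>01: "0 < \<psi> t" "\<psi> t < 1" if "t \<in> {0..t1}" for t
      using l1[OF that] by (auto simp: \<psi>_def)
    have ln\<psi>: "ln (1 / \<psi> t) = l t" for t by (simp add: \<psi>_def ln_div)
    have d\<psi>: "(\<psi> has_real_derivative A * l t * \<psi> t) (at t within S)" for t S
      unfolding \<psi>_def[abs_def] l_def by (auto intro!: derivative_eq_intros simp: mult_ac)
    define w where "w x t = \<psi> t - fst (snd x) * \<omega>_even (fst x) t - snd (snd x) * u_z_even (fst x) t"
      for x :: "real \<times> real \<times> real" and t
    \<comment> \<open>With these coefficients \<open>w\<close> is \<open>\<psi>\<close> minus one of \<open>\<plusminus>\<omega>_even\<close>, \<open>\<plusminus>u_z_even\<close>, so a single barrier argument bounds both functions on both sides.\<close>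
    define Q where "Q = {(1, 0), (-1, 0), (0, 1), (0, -1) :: real \<times> real}"
    have pos: "w (z, q) t > 0" if z: "z \<in> {0..L}" and q: "q \<in> Q" and t: "t \<in> {0..t1}" for z q t
    proof (rule first_touch[where X="{0..L} \<times> Q" and w=w and t=t and x="(z, q)"])
      show "compact ({0..L} \<times> Q)" by (rule compact_Times[OF compact_Icc finite_imp_compact]) (simp add: Q_def)
      have c: "continuous_on (({0..L} \<times> Q) \<times> {0..t1}) (\<lambda>x. f (h x) (snd x))"
        if "smooth_spacetime T f" "continuous_on (({0..L} \<times> Q) \<times> {0..t1}) h" for f h
        using continuous_on_compose2[OF smooth_continuous[OF that(1)], of "(({0..L} \<times> Q) \<times> {0..t1})" "\<lambda>x. (h x, snd x)"]
          that(2) tI by (simp add: continuous_on_Pair continuous_on_snd image_subset_iff mem_Times_iff)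
      have "continuous_on (({0..L} \<times> Q) \<times> {0..t1}) (\<lambda>x. \<psi> (snd x))"
        unfolding \<psi>_def l_def by (intro continuous_intros)
      then show "continuous_on (({0..L} \<times> Q) \<times> {0..t1}) (\<lambda>(x, t). w x t)"
        unfolding w_def \<omega>_even_def u_z_even_def split_beta
        by (intro continuous_intros c[OF \<omega>_smooth, of "\<lambda>x. fst (fst x)"] c[OF \<omega>_smooth, of "\<lambda>x. - fst (fst x)"]
          c[OF smooth_dz[OF u_smooth], of "\<lambda>x. fst (fst x)"] c[OF smooth_dz[OF u_smooth], of "\<lambda>x. - fst (fst x)"])
      have "u_z_even y 0 = 0" for y by (simp add: u_z_even_def u_z_init)
      then show "w x 0 > 0" if "x \<in> {0..L} \<times> Q" for x
        by (simp add: w_def \<omega>_even_def \<omega>_init \<psi>_def)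
    next
      fix x t assume x: "x \<in> {0..L} \<times> Q" and "t \<in> {0<..t1}" and w0: "w x t = 0"
        and min: "\<And>y. y \<in> {0..L} \<times> Q \<Longrightarrow> 0 \<le> w y t"
      then have t: "t \<in> {0..t1}" by auto
      note [simp] = tI[OF t]
      have lt: "l t \<ge> 1" and \<psi>: "0 < \<psi> t" "\<psi> t < 1" using l1[OF t] \<psi>01[OF t] by auto
      obtain z \<sigma> \<tau> where xz: "x = (z, \<sigma>, \<tau>)" by (cases x)
      have z: "z \<in> {0..L}" and q: "(\<sigma>, \<tau>) \<in> Q" using x by (auto simp: xz)
      note per = even_periodic[OF tI[OF t]]
      have all: "0 \<le> w (y, q) t" if "q \<in> Q" for y q
      proof -
        obtain k :: int where k: "y + of_int k * L \<in> {0..L}" using periodic_reduce[OF L] .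
        have "w (y + of_int k * L, q) t = w (y, q) t"
          by (rule periodic_shift_int[where f="\<lambda>y. w (y, q) t"]) (simp add: w_def per)
        then show ?thesis using min[of "(y + of_int k * L, q)"] k that by auto
      qed
      have \<omega>b: "\<bar>\<omega>_even y t\<bar> \<le> \<psi> t" and ub: "\<bar>u_z_even y t\<bar> \<le> \<psi> t" for y
        using all[of "(1, 0)" y] all[of "(-1, 0)" y] all[of "(0, 1)" y] all[of "(0, -1)" y]
        by (auto simp: w_def Q_def)
      define wz where "wz = \<sigma> * (dz \<omega> z t - dz \<omega> (- z) t) + \<tau> * (dz (dz u) z t - dz (dz u) (- z) t)"
      have "((\<lambda>y. w (y, \<sigma>, \<tau>) t) has_real_derivative - wz) (at z)"
        unfolding w_def wz_def
        by (auto intro!: derivative_eq_intros \<omega>_even_deriv u_z_even_deriv)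
      then have "- wz = 0"
        by (rule DERIV_local_min[where d=1]) (use all[OF q] w0 in \<open>auto simp: xz\<close>)
      then have wz: "wz = 0" by simp
      define B where "B = 2 / pi * (2 * M * (\<psi> t * (L/2)) + \<psi> t * ln (1 / \<psi> t))"
      note vb = v_even_bound[OF tI[OF t] M(1)[OF t] \<psi> \<omega>b, folded B_def]
      have B0: "B \<ge> 0" using vb(1)[of 0] by simp
      have B: "B \<le> (M * L + 1) * (l t * \<psi> t)"
      proof -
        have "B = 2 / pi * ((M * L + l t) * \<psi> t)" unfolding B_def ln\<psi> by (simp add: algebra_simps)
        also have "\<dots> \<le> 1 * ((M * L + l t) * \<psi> t)"
          using \<psi> M0 L lt pi_ge_two by (intro mult_right_mono) auto
        also have "M * L \<le> M * L * l t" using lt M0 L mult_left_mono[of 1 "l t" "M * L"] by simp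
        then have "1 * ((M * L + l t) * \<psi> t) \<le> 1 * ((M * L * l t + l t) * \<psi> t)"
          using \<psi> by (intro mult_left_mono mult_right_mono) auto
        also have "\<dots> = (M * L + 1) * (l t * \<psi> t)" by (simp add: algebra_simps)
        finally show ?thesis .
      qed
      define E1 where "E1 = u_z_even z t - v_even z t * dz \<omega> (- z) t"
      define E2 where "E2 = - v_even z t * dz (dz u) (- z) t - v_z z t * u_z_even z t + (v_z z t - v_z (- z) t) * dz u (- z) t"
      have p1: "\<bar>v_even z t * f\<bar> \<le> B * L * M" if "\<bar>f\<bar> \<le> M" for f
        unfolding abs_mult using vb(2)[OF z] that B0 L by (intro mult_mono) auto
      have "\<bar>E1\<bar> \<le> \<psi> t + B * L * M"
        unfolding E1_def using ub[of z] p1[OF M(1)[OF t, of "- z"]] by linarith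
      moreover have "\<bar>v_z z t * u_z_even z t\<bar> \<le> K * \<psi> t"
        unfolding abs_mult using K[OF t] ub K0 by (intro mult_mono) auto
      moreover have "\<bar>(v_z z t - v_z (- z) t) * dz u (- z) t\<bar> \<le> B * M"
        unfolding abs_mult using vb(1) M(2)[OF t] B0 by (intro mult_mono) auto
      ultimately have E: "\<bar>E1\<bar> \<le> (1 + K) * \<psi> t + B * (M * (L + 1))" "\<bar>E2\<bar> \<le> (1 + K) * \<psi> t + B * (M * (L + 1))"
        using p1[OF M(3)[OF t, of "- z"]] \<psi>(1) mult_nonneg_nonneg[OF K0, of "\<psi> t"] mult_nonneg_nonneg[OF B0 M0]
        unfolding E2_def by (simp_all add: algebra_simps)
      have "B * (M * (L + 1)) \<le> (M * L + 1) * (l t * \<psi> t) * (M * (L + 1))"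
        using B M0 L by (intro mult_right_mono) auto
      moreover have "(1 + K) * \<psi> t \<le> (1 + K) * (l t * \<psi> t)"
        using K0 \<psi> lt mult_right_mono[of 1 "l t" "\<psi> t"] by (intro mult_left_mono) auto
      moreover have "l t * \<psi> t > 0" using lt \<psi> by simp
      ultimately have "(1 + K) * \<psi> t + B * (M * (L + 1)) < A * l t * \<psi> t"
        unfolding A_def by (simp add: algebra_simps)
      then have E': "\<bar>E1\<bar> < A * l t * \<psi> t" "\<bar>E2\<bar> < A * l t * \<psi> t" using E by auto
      have "((\<lambda>s. w x s) has_real_derivative A * l t * \<psi> t
         - \<sigma> * (u_z_even z t - v z t * (dz \<omega> z t - dz \<omega> (- z) t) - v_even z t * dz \<omega> (- z) t)
         - \<tau> * (- v z t * (dz (dz u) z t - dz (dz u) (- z) t) - v_even z t * dz (dz u) (- z) t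
            - v_z z t * u_z_even z t + (v_z z t - v_z (- z) t) * dz u (- z) t)) (at t within {0..t1})"
        unfolding w_def xz fst_conv snd_conv
        by (intro DERIV_diff DERIV_cmult d\<psi> \<omega>_even_deriv_t[OF t1 t] u_z_even_deriv_t[OF t1 t])
      also have "A * l t * \<psi> t
         - \<sigma> * (u_z_even z t - v z t * (dz \<omega> z t - dz \<omega> (- z) t) - v_even z t * dz \<omega> (- z) t)
         - \<tau> * (- v z t * (dz (dz u) z t - dz (dz u) (- z) t) - v_even z t * dz (dz u) (- z) t
            - v_z z t * u_z_even z t + (v_z z t - v_z (- z) t) * dz u (- z) t)
         = A * l t * \<psi> t - \<sigma> * E1 - \<tau> * E2 + v z t * wz"
        unfolding E1_def E2_def wz_def by (simp add: algebra_simps)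
      finally have "((\<lambda>s. w x s) has_real_derivative A * l t * \<psi> t - \<sigma> * E1 - \<tau> * E2) (at t within {0..t1})"
        by (simp add: wz)
      moreover have "A * l t * \<psi> t - \<sigma> * E1 - \<tau> * E2 > 0"
        using q E' by (auto simp: Q_def)
      ultimately show "\<exists>D>0. ((\<lambda>s. w x s) has_real_derivative D) (at t within {0..t1})" by blast
    qed (use z q t in auto)
    show ?thesis
      using pos[OF z, of "(1, 0)" t1] pos[OF z, of "(-1, 0)" t1] pos[OF z, of "(0, 1)" t1] pos[OF z, of "(0, -1)" t1] t1_0
      by (auto simp: w_def Q_def \<psi>_def l_def)
  qed
  then have "\<bar>\<omega>_even z t1\<bar> \<le> 0" "\<bar>u_z_even z t1\<bar> \<le> 0"
    by (auto intro!: nonpos_if_below_all_exp[of "exp (- A * t1)" "exp (A * t1)"] simp del: abs_le_zero_iff)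
  then show "\<omega>_even z t1 = 0" "u_z_even z t1 = 0" by simp_all
qed

lemma \<omega>_odd: "t \<in> I \<Longrightarrow> \<omega> (- z) t = - \<omega> z t"
proof -
  assume t: "t \<in> I"
  obtain k :: int where k: "z + of_int k * L \<in> {0..L}" using periodic_reduce[OF L] .
  have "\<omega>_even (z + of_int k * L) t = \<omega>_even z t"
    by (rule periodic_shift_int[where f="\<lambda>y. \<omega>_even y t"]) (rule even_periodic[OF t])
  then show ?thesis using even_parts_vanish(1)[OF t k] by (simp add: \<omega>_even_def)
qed

lemma v_odd: "t \<in> I \<Longrightarrow> z \<in> {0..L} \<Longrightarrow> v (- z) t = - v z t"
proof -
  assume t: "t \<in> I" and z: "z \<in> {0..L}"
  have "v_z x t - v_z (- x) t = 0" for x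
  proof -
    have "\<omega>_even y t = 0" for y by (simp add: \<omega>_even_def \<omega>_odd[OF t])
    then show ?thesis unfolding v_z_odd_part[OF t] hilbert_sym_def by simp
  qed
  then have "\<bar>v_even z t\<bar> \<le> 0 * L"
    by (intro zero_mean_bound[OF L v_even_deriv[OF t] _ v_even_mean[OF t] z]) auto
  then show ?thesis by (simp add: v_even_def)
qed

lemma v_at_zero: "t \<in> I \<Longrightarrow> v 0 t = 0"
  using v_odd[of t 0] L by simp

lemma v_at_half: "t \<in> I \<Longrightarrow> v (L/2) t = 0"
  using v_odd[of t "L/2"] v_periodic[of t "- (L/2)"] L by simp

lemma u_z_at_zero: "t \<in> I \<Longrightarrow> dz u 0 t = 0"
  using even_parts_vanish(2)[of t 0] L by (simp add: u_z_even_def)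

end

section \<open>Consequences of convexity on the half period\<close>

lemma cot_deriv_scaled:
  fixes \<mu> z :: real
  assumes "sin (\<mu> * z) \<noteq> 0"
  shows "((\<lambda>z. cot (\<mu> * z)) has_real_derivative - \<mu> / (sin (\<mu> * z))\<^sup>2) (at z within S)"
proof -
  have "((\<lambda>z. \<mu> * z) has_real_derivative \<mu>) (at z within S)" by (auto intro!: derivative_eq_intros)
  from DERIV_chain2[OF DERIV_cot[OF assms] this] show ?thesis by (simp add: divide_inverse mult.commute)
qed

lemma sin_cos_pos_quarter:
  fixes L z :: real
  assumes "0 < z" "z < L/2"
  shows "sin (pi / L * z) > 0" "cos (pi / L * z) > 0"
proof -
  show "sin (pi / L * z) > 0" using sin_pos_half[of z L] assms by simp
  have "pi / L * z < pi / L * (L / 2)" using assms by (intro mult_strict_left_mono) auto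
  then have "pi / L * z < pi / 2" using assms by simp
  moreover have "0 < pi / L * z" using assms by simp
  then have "- (pi / 2) < pi / L * z" using pi_gt_zero by linarith
  ultimately show "cos (pi / L * z) > 0" by (intro cos_gt_zero_pi)
qed

locale convex_solution = model_solution +
  assumes convex: "\<And>z t. z \<in> {0<..<L/2} \<Longrightarrow> t \<in> times_upto T \<Longrightarrow> dz (dz v) z t \<ge> 0"
begin

abbreviation "\<mu> \<equiv> pi / L"

lemma v_z_mono:
  assumes "t \<in> I" "0 \<le> x" "x \<le> y" "y \<le> L/2"
  shows "v_z x t \<le> v_z y t"
proof (rule DERIV_nonneg_imp_increasing_open[OF assms(3)])
  show "\<exists>d. ((\<lambda>z. v_z z t) has_real_derivative d) (at s) \<and> 0 \<le> d" if "x < s" "s < y" for s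
    using v_z_deriv[OF assms(1), of s] convex[of s t] dz_dz_v[OF assms(1), of s] that assms by auto
  show "continuous_on {x..y} (\<lambda>z. v_z z t)"
    by (rule DERIV_continuous_on, rule DERIV_subset[OF v_z_deriv[OF assms(1)]]) simp
qed

text \<open>At an interior minimum the derivative vanishes, at the ends of the half period the velocity does.\<close>

lemma transport_term_zero:
  assumes t: "t \<in> I" and f: "(f has_real_derivative d) (at z)"
    and min: "\<And>y. y \<in> {p..q} \<Longrightarrow> f z \<le> f y"
    and z: "z = 0 \<or> z = L/2 \<or> (p < z \<and> z < q)"
  shows "v z t * d = 0"
proof (cases "p < z \<and> z < q")
  case True
  have "d = 0"
    by (rule DERIV_local_min[OF f, of "min (z - p) (q - z)"]) (use True min in \<open>auto simp: abs_if split: if_splits\<close>)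
  then show ?thesis by simp
qed (use z v_at_zero[OF t] v_at_half[OF t] in auto)

text \<open>Along the flow \<open>u_z\<close> satisfies the homogeneous equation \<open>(u_z)' = - v_z u_z\<close>.\<close>

lemma u_z_nonneg:
  assumes t1: "t1 \<in> I" and z: "z \<in> {0..L/2}"
  shows "dz u z t1 \<ge> 0"
proof -
  obtain K where K: "\<And>z t. t \<in> {0..t1} \<Longrightarrow> \<bar>v_z z t\<bar> \<le> K" using v_z_bounded[OF t1] by blast
  show ?thesis
  proof (rule minimum_principle[where X="{0..L/2}" and w="dz u" and K=K and t=t1 and x=z])
    show "continuous_on ({0..L/2} \<times> {0..t1}) (\<lambda>(x, t). dz u x t)"
      by (rule continuous_on_subset[OF smooth_continuous[OF smooth_dz[OF u_smooth]]])
        (use times_upto_interval[OF t1] in auto)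
    show "dz u x 0 \<ge> 0" if x: "x \<in> {0..L/2}" for x
    proof -
      have "sin (pi / L * (2 * x)) \<ge> 0"
        by (cases "2 * x = 0 \<or> 2 * x = L") (use x L sin_pos_half[of "2 * x" L] in auto)
      then show ?thesis unfolding u_z_init using a L by (simp add: mult.left_commute)
    qed
    fix x t assume x: "x \<in> {0..L/2}" and "t \<in> {0<..t1}" and min: "\<And>y. y \<in> {0..L/2} \<Longrightarrow> dz u x t \<le> dz u y t"
    then have t: "t \<in> {0..t1}" and tI: "t \<in> I" using times_upto_interval[OF t1] by auto
    have "v x t * dz (dz u) x t = 0"
      by (rule transport_term_zero[where p=0 and q="L/2", OF tI u_z_deriv[OF tI] min]) (use x in auto)
    then have "dt T (dz u) x t = - v_z x t * dz u x t" unfolding u_z_eq[OF tI] by simp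
    then show "\<exists>D c. (dz u x has_real_derivative D) (at t within {0..t1}) \<and> \<bar>c\<bar> \<le> K \<and> c * dz u x t \<le> D"
      using deriv_t_within[OF smooth_dz[OF u_smooth] t1 t, of x] K[OF t, of x]
      by (intro exI[of _ "dt T (dz u) x t"] exI[of _ "- v_z x t"]) auto
  qed (use t1 z in \<open>auto simp: times_upto_def\<close>)
qed

lemma \<omega>_nonneg:
  assumes t1: "t1 \<in> I" and z: "z \<in> {0..L/2}"
  shows "\<omega> z t1 \<ge> 0"
proof (rule minimum_principle[where X="{0..L/2}" and w="\<omega>" and K=0 and t=t1 and x=z])
  show "continuous_on ({0..L/2} \<times> {0..t1}) (\<lambda>(x, t). \<omega> x t)"
    by (rule continuous_on_subset[OF smooth_continuous[OF \<omega>_smooth]])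
      (use times_upto_interval[OF t1] in auto)
  fix x t assume x: "x \<in> {0..L/2}" and "t \<in> {0<..t1}" and min: "\<And>y. y \<in> {0..L/2} \<Longrightarrow> \<omega> x t \<le> \<omega> y t"
  then have t: "t \<in> {0..t1}" and tI: "t \<in> I" using times_upto_interval[OF t1] by auto
  have "v x t * dz \<omega> x t = 0"
    by (rule transport_term_zero[where p=0 and q="L/2", OF tI \<omega>_deriv[OF tI] min]) (use x in auto)
  then have "dt T \<omega> x t \<ge> 0" unfolding \<omega>_eq[OF tI] using u_z_nonneg[OF tI x] by linarith
  then show "\<exists>D c. (\<omega> x has_real_derivative D) (at t within {0..t1}) \<and> \<bar>c\<bar> \<le> 0 \<and> c * \<omega> x t \<le> D"
    using deriv_t_within[OF \<omega>_smooth t1 t, of x]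
    by (intro exI[of _ "dt T \<omega> x t"] exI[of _ 0]) auto
qed (use t1 z in \<open>auto simp: times_upto_def \<omega>_init\<close>)

text \<open>This is the monotonicity of \<open>\<omega>/u_z\<close> without division. The difference of the two sides is transported by the product flow on
  the triangle \<open>x \<le> y\<close>, with growth rate \<open>- v_z x\<close> and the source \<open>(v_z y - v_z x) \<omega> x u_z y\<close>, which is nonnegative because \<open>v\<close> is convex.
  On the diagonal the difference is \<open>0\<close>.\<close>

lemma ratio_increasing:
  assumes t1: "t1 \<in> I" and xy: "0 \<le> x" "x \<le> y" "y \<le> L/2"
  shows "\<omega> x t1 * dz u y t1 \<le> \<omega> y t1 * dz u x t1"
proof -
  obtain K where K: "\<And>z t. t \<in> {0..t1} \<Longrightarrow> \<bar>v_z z t\<bar> \<le> K" using v_z_bounded[OF t1] by blast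
  define X where "X = ({0..L/2} \<times> {0..L/2}) \<inter> {p. fst p \<le> snd p}"
  define w where "w p t = \<omega> (snd p) t * dz u (fst p) t - \<omega> (fst p) t * dz u (snd p) t" for p :: "real \<times> real" and t
  have "w (x, y) t1 \<ge> 0"
  proof (rule minimum_principle[where X=X and w=w and K=K and t=t1 and x="(x, y)"])
    show "compact X" unfolding X_def
      by (intro compact_Int_closed compact_Times compact_Icc closed_Collect_le continuous_intros)
    have c: "continuous_on (X \<times> {0..t1}) (\<lambda>x. f (h x) (snd x))"
      if "smooth_spacetime T f" "continuous_on (X \<times> {0..t1}) h" for f h
      using continuous_on_compose2[OF smooth_continuous[OF that(1)], of "X \<times> {0..t1}" "\<lambda>x. (h x, snd x)"]
        that(2) times_upto_interval[OF t1] by (auto simp: continuous_on_Pair continuous_on_snd image_subset_iff mem_Times_iff)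
    show "continuous_on (X \<times> {0..t1}) (\<lambda>(x, t). w x t)"
      unfolding w_def split_beta
      by (intro continuous_intros c[OF \<omega>_smooth, of "\<lambda>x. fst (fst x)"] c[OF \<omega>_smooth, of "\<lambda>x. snd (fst x)"]
          c[OF smooth_dz[OF u_smooth], of "\<lambda>x. fst (fst x)"] c[OF smooth_dz[OF u_smooth], of "\<lambda>x. snd (fst x)"])
    fix p t assume p: "p \<in> X" and "t \<in> {0<..t1}" and neg: "w p t < 0" and min: "\<And>q. q \<in> X \<Longrightarrow> w p t \<le> w q t"
    then have t: "t \<in> {0..t1}" and tI: "t \<in> I" using times_upto_interval[OF t1] by auto
    obtain x y where pxy: "p = (x, y)" by (cases p)
    have "x \<noteq> y" using neg by (auto simp: pxy w_def)
    then have xy: "0 \<le> x" "x < y" "y \<le> L/2" using p by (auto simp: pxy X_def)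
    have zx: "v x t * (\<omega> y t * dz (dz u) x t - dz \<omega> x t * dz u y t) = 0"
    proof (rule transport_term_zero[OF tI, where p=0 and q=y and f="\<lambda>x. w (x, y) t"])
      show "((\<lambda>x. w (x, y) t) has_real_derivative \<omega> y t * dz (dz u) x t - dz \<omega> x t * dz u y t) (at x)"
        unfolding w_def by (auto intro!: derivative_eq_intros u_z_deriv[OF tI] \<omega>_deriv[OF tI])
      show "w (x, y) t \<le> w (s, y) t" if "s \<in> {0..y}" for s
        using min[of "(s, y)"] that xy by (auto simp: pxy X_def)
    qed (use xy in auto)
    have zy: "v y t * (dz \<omega> y t * dz u x t - \<omega> x t * dz (dz u) y t) = 0"
    proof (rule transport_term_zero[OF tI, where p=x and q="L/2" and f="\<lambda>y. w (x, y) t"])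
      show "((\<lambda>y. w (x, y) t) has_real_derivative dz \<omega> y t * dz u x t - \<omega> x t * dz (dz u) y t) (at y)"
        unfolding w_def by (auto intro!: derivative_eq_intros u_z_deriv[OF tI] \<omega>_deriv[OF tI])
      show "w (x, y) t \<le> w (x, s) t" if "s \<in> {x..L/2}" for s
        using min[of "(x, s)"] that xy by (auto simp: pxy X_def)
    qed (use xy in auto)
    define D where "D = (dz u y t - v y t * dz \<omega> y t) * dz u x t - \<omega> y t * (v_z x t * dz u x t + v x t * dz (dz u) x t)
       - ((dz u x t - v x t * dz \<omega> x t) * dz u y t - \<omega> x t * (v_z y t * dz u y t + v y t * dz (dz u) y t))"
    note du = deriv_t_within[OF smooth_dz[OF u_smooth] t1 t, unfolded u_z_eq[OF tI]]
      and dw = deriv_t_within[OF \<omega>_smooth t1 t, unfolded \<omega>_eq[OF tI]]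
    have "(w p has_real_derivative D) (at t within {0..t1})"
      unfolding w_def[abs_def] pxy D_def fst_conv snd_conv
      by (rule DERIV_cong[OF DERIV_diff[OF DERIV_mult[OF dw du] DERIV_mult[OF dw du]]]) (simp add: algebra_simps)
    moreover have "D = - v_z x t * w p t + (v_z y t - v_z x t) * (\<omega> x t * dz u y t)
        - v x t * (\<omega> y t * dz (dz u) x t - dz \<omega> x t * dz u y t) - v y t * (dz \<omega> y t * dz u x t - \<omega> x t * dz (dz u) y t)"
      unfolding D_def w_def pxy by (simp add: algebra_simps)
    then have "D = - v_z x t * w p t + (v_z y t - v_z x t) * (\<omega> x t * dz u y t)"
      unfolding zx zy by simp
    moreover have "(v_z y t - v_z x t) * (\<omega> x t * dz u y t) \<ge> 0"
      using v_z_mono[OF tI, of x y] \<omega>_nonneg[OF tI, of x] u_z_nonneg[OF tI, of y] xy by simp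
    ultimately show "\<exists>D c. (w p has_real_derivative D) (at t within {0..t1}) \<and> \<bar>c\<bar> \<le> K \<and> c * w p t \<le> D"
      using K[OF t, of x] by (intro exI[of _ D] exI[of _ "- v_z x t"]) auto
  qed (use t1 xy in \<open>auto simp: times_upto_def X_def w_def \<omega>_init\<close>)
  then show ?thesis by (simp add: w_def)
qed

definition G :: "real \<Rightarrow> real \<Rightarrow> real" where
  "G z t = 2 / L * integral {z..L/2} (\<lambda>y. \<omega> y t * cot (\<mu> * y))"

text \<open>The primitive \<open>A\<close> of \<open>\<omega>\<close> is even and periodic, and it increases on the half period; \<open>v\<close> is the Hilbert transform of
  \<open>A\<close>, since both have the derivative \<open>v_z\<close> and vanish at \<open>0\<close>. The bound for even increasing
  functions then applies to \<open>A\<close>, and integration by parts turns \<open>\<integral> (A y - A z) / sin\<^sup>2\<close> into \<open>\<integral> \<omega> cot\<close>.\<close>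

lemma v_upper_bound:
  assumes t: "t \<in> I" and z: "0 < z" "z < L/2"
  shows "\<mu> * v z t \<le> - (sin (\<mu> * z) * cos (\<mu> * z) * G z t)"
proof -
  have c\<omega>: "continuous_on S (\<lambda>z. \<omega> z t)" for S by (rule smooth_continuous_z[OF \<omega>_smooth t])
  obtain A where A: "\<And>x. (A has_real_derivative \<omega> x t) (at x)" "A 0 = 0"
    using antiderivative_real_line[OF c\<omega>] by blast
  have "((\<lambda>x. A x - A (- x)) has_real_derivative 0) (at x)" for x
    using DERIV_diff[OF A(1) DERIV_chain2[OF A(1) DERIV_minus[OF DERIV_ident]], of x] by (simp add: \<omega>_odd[OF t])
  from DERIV_isconst_all[of "\<lambda>x. A x - A (- x)" _ 0] this
  have even: "A (- x) = A x" for x by (metis diff_self eq_iff_diff_eq_0 minus_zero)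
  have "((\<lambda>x. A (x + L) - A x) has_real_derivative 0) (at x)" for x
    using DERIV_diff[OF A(1)[of "x + L", unfolded DERIV_shift] A(1)] by (simp add: \<omega>_periodic[OF t])
  then have "A (x + L) - A x = A (- (L/2) + L) - A (- (L/2))" for x
    by (intro DERIV_isconst_all allI)
  then have per: "A (x + L) = A x" for x using even[of "L/2"] by simp
  have "((\<lambda>x. v x t - hilbert_sym L A x) has_real_derivative 0) (at x)" for x
    using DERIV_diff[OF v_deriv[OF t] hilbert_sym_deriv[OF L A(1) \<omega>_deriv[OF t] smooth_continuous_z[OF smooth_dz[OF \<omega>_smooth] t]], of x]
    by (simp add: v_z_def)
  then have "v z t - hilbert_sym L A z = v 0 t - hilbert_sym L A 0"
    by (intro DERIV_isconst_all allI)
  moreover have "hilbert_sym L A 0 = 0" by (simp add: hilbert_sym_def even)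
  ultimately have v: "v z t = hilbert_sym L A z" using v_at_zero[OF t] by simp
  have mono: "A x \<le> A y" if "0 \<le> x" "x \<le> y" "y \<le> L/2" for x y
    by (rule DERIV_nonneg_imp_nondecreasing[OF that(2)]) (use that A(1) \<omega>_nonneg[OF t] in force)
  define J where "J = integral {z..L/2} (\<lambda>y. (A y - A z) / (sin (\<mu> * y))\<^sup>2)"
  have sn: "sin (\<mu> * y) \<noteq> 0" if "y \<in> {z..L/2}" for y
    using sin_pos_half[of y L] that z by auto
  have "((\<lambda>y. (A y - A z) / (sin (\<mu> * y))\<^sup>2 - L / pi * (\<omega> y t * cot (\<mu> * y))) has_integral
      - (L / pi * ((A (L/2) - A z) * cot (\<mu> * (L/2)))) - - (L / pi * ((A z - A z) * cot (\<mu> * z)))) {z..L/2}"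
  proof (rule fundamental_theorem_of_calculus)
    fix y assume y: "y \<in> {z..L/2}"
    have "((\<lambda>y. (A y - A z) * cot (\<mu> * y)) has_real_derivative \<omega> y t * cot (\<mu> * y) + - \<mu> / (sin (\<mu> * y))\<^sup>2 * (A y - A z)) (at y within {z..L/2})"
      by (rule DERIV_cong[OF DERIV_mult[OF DERIV_diff[OF DERIV_subset[OF A(1)] DERIV_const] cot_deriv_scaled[OF sn[OF y]]]]) auto
    from DERIV_minus[OF DERIV_cmult[OF this, of "L / pi"]]
    show "((\<lambda>y. - (L / pi * ((A y - A z) * cot (\<mu> * y)))) has_vector_derivative
        (A y - A z) / (sin (\<mu> * y))\<^sup>2 - L / pi * (\<omega> y t * cot (\<mu> * y))) (at y within {z..L/2})"
      unfolding has_real_derivative_iff_has_vector_derivative[symmetric]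
      by (rule DERIV_cong) (use L in \<open>simp add: divide_simps; simp add: algebra_simps\<close>)
  qed (use z in auto)
  then have parts: "((\<lambda>y. (A y - A z) / (sin (\<mu> * y))\<^sup>2 - L / pi * (\<omega> y t * cot (\<mu> * y))) has_integral 0) {z..L/2}"
    unfolding cot_half[OF L] by simp
  have "continuous_on {z..L/2} (\<lambda>y. \<omega> y t * cot (\<mu> * y))"
    by (intro continuous_on_mult[OF c\<omega>] continuous_on_cot continuous_intros) (use sn in auto)
  then have "((\<lambda>y. \<omega> y t * cot (\<mu> * y)) has_integral L / 2 * G z t) {z..L/2}"
    unfolding G_def using L by (simp add: integrable_integral integrable_continuous_interval)
  from has_integral_add[OF parts has_integral_mult_right[OF this, of "L / pi"]]
  have J: "J = L / pi * (L / 2 * G z t)" unfolding J_def by (intro integral_unique) simp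
  have "sin (2 * (\<mu> * z)) / L * J \<le> - v z t" unfolding v J_def
    by (rule hilbert_even_lower_bound[OF L per even A(1) c\<omega> mono z])
  then have "\<mu> * (sin (2 * (\<mu> * z)) / L * J) \<le> \<mu> * - v z t" using L by (intro mult_left_mono) auto
  moreover have "\<mu> * (sin (2 * (\<mu> * z)) / L * J) = sin (\<mu> * z) * cos (\<mu> * z) * G z t"
    unfolding J sin_double using L by simp
  ultimately show ?thesis by simp
qed

lemma G_nonneg:
  assumes t: "t \<in> I" and z: "0 \<le> z"
  shows "G z t \<ge> 0"
proof -
  have "0 \<le> \<omega> y t * cot (\<mu> * y)" if "y \<in> {z..L/2}" for y
    using that z \<omega>_nonneg[OF t, of y] cot_bounds_half(1)[of y L]
    by (cases "y = 0") (auto simp del: times_divide_eq_left)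
  then have "integral {z..L/2} (\<lambda>y. \<omega> y t * cot (\<mu> * y)) \<ge> 0"
    by (metis (lifting) integral_nonneg not_integrable_integral order.refl)
  then show ?thesis using L by (simp add: G_def)
qed

lemma v_nonpos:
  assumes t: "t \<in> I" and z: "0 < z" "z < L/2"
  shows "v z t \<le> 0"
proof -
  have "sin (\<mu> * z) > 0" "cos (\<mu> * z) \<ge> 0"
    using sin_cos_pos_quarter[OF z] by auto
  then have "sin (\<mu> * z) * cos (\<mu> * z) * G z t \<ge> 0" using G_nonneg[OF t] z by simp
  then have "\<mu> * v z t \<le> 0" using v_upper_bound[OF t z] by linarith
  then show ?thesis using L pi_gt_zero by (auto simp: mult_le_0_iff divide_le_0_iff)
qed

text \<open>The expression is the derivative of \<open>v cot\<close>. Convexity gives \<open>v_z \<ge> v / z\<close>, and then \<open>v \<le> 0\<close> and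
  \<open>sin x cos x \<le> x\<close> suffice.\<close>

lemma v_cot_increasing:
  assumes t: "t \<in> I" and z: "0 < z" "z < L/2"
  shows "v_z z t * cot (\<mu> * z) - \<mu> * v z t / (sin (\<mu> * z))\<^sup>2 \<ge> 0"
proof -
  obtain \<xi> where \<xi>: "0 < \<xi>" "\<xi> < z" "v z t - v 0 t = (z - 0) * v_z \<xi> t"
    using MVT2[OF z(1), of "\<lambda>x. v x t" "\<lambda>x. v_z x t"] v_deriv[OF t] by blast
  have "v z t \<le> z * v_z z t"
    using \<xi> v_z_mono[OF t, of \<xi> z] z v_at_zero[OF t] by (simp add: mult_left_mono)
  then have vz: "v z t / z \<le> v_z z t" using z by (simp add: divide_le_eq mult.commute)
  have s: "sin (\<mu> * z) > 0" and c: "cos (\<mu> * z) \<ge> 0"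
    using sin_cos_pos_quarter[OF z] by auto
  have "sin (\<mu> * z) * cos (\<mu> * z) \<le> (\<mu> * z) * 1"
    using z L s c sin_x_le_x[of "\<mu> * z"] by (intro mult_mono) auto
  then have "sin (\<mu> * z) * cos (\<mu> * z) / z \<le> \<mu>" using z by (simp only: pos_divide_le_eq mult_1_right)
  then have "v z t * \<mu> \<le> v z t * (sin (\<mu> * z) * cos (\<mu> * z) / z)"
    using v_nonpos[OF t z] by (intro mult_left_mono_neg)
  also have "\<dots> = v z t / z * (sin (\<mu> * z) * cos (\<mu> * z))" by simp
  also have "\<dots> \<le> v_z z t * (sin (\<mu> * z) * cos (\<mu> * z))"
    using vz s c by (intro mult_right_mono) auto
  finally have "0 \<le> (v_z z t * (sin (\<mu> * z) * cos (\<mu> * z)) - v z t * \<mu>) / (sin (\<mu> * z))\<^sup>2" by simp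
  also have "\<dots> = v_z z t * cot (\<mu> * z) - \<mu> * v z t / (sin (\<mu> * z))\<^sup>2"
    using s by (simp add: cot_def diff_divide_distrib power2_eq_square)
  finally show ?thesis .
qed

end

section \<open>The differential inequalities and blowup\<close>

lemma tail_integral:
  fixes e :: "real \<Rightarrow> real"
  assumes e: "continuous_on {0..h} e"
  shows "z \<in> {0<..<h} \<Longrightarrow> ((\<lambda>z. integral {z..h} e) has_real_derivative - e z) (at z)"
    and "continuous_on {0..h} (\<lambda>z. integral {z..h} e)"
proof -
  have i: "e integrable_on {0..h}" by (rule integrable_continuous_interval[OF e])
  show "continuous_on {0..h} (\<lambda>z. integral {z..h} e)" by (rule indefinite_integral_continuous_1'[OF i])
  assume z: "z \<in> {0<..<h}"
  have "((\<lambda>z. integral {0..z} e) has_real_derivative e z) (at z within {0..h})"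
    by (rule integral_has_real_derivative[OF e]) (use z in auto)
  moreover have "z \<in> interior {0..h}" using z by auto
  ultimately have "((\<lambda>z. integral {0..z} e) has_real_derivative e z) (at z)"
    by (metis at_within_interior)
  from DERIV_diff[OF DERIV_const[of "integral {0..h} e"] this]
  have "((\<lambda>z. integral {0..h} e - integral {0..z} e) has_real_derivative - e z) (at z)" by simp
  then show "((\<lambda>z. integral {z..h} e) has_real_derivative - e z) (at z)"
  proof (rule has_field_derivative_transform_within_open[of _ _ _ "{0<..<h}"])
    show "integral {0..h} e - integral {0..y} e = integral {y..h} e" if "y \<in> {0<..<h}" for y
      using Henstock_Kurzweil_Integration.integral_combine[OF _ _ i, of y] that by auto
  qed (use z in auto)
qed

context convex_solution
begin

definition strain :: "real \<Rightarrow> real" where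
  "strain t = 2 / L * integral {0..L/2} (\<lambda>z. \<omega> z t * cot (\<mu> * z))"
definition gradient_moment :: "real \<Rightarrow> real" where
  "gradient_moment t = 2 / L * integral {0..L/2} (\<lambda>z. dz u z t * cot (\<mu> * z))"

lemma strain_eq: "t \<in> I \<Longrightarrow> strain t = - v_z 0 t"
proof -
  assume t: "t \<in> I"
  have "(\<lambda>s. (\<omega> (0 - s) t - \<omega> (0 + s) t) * cot (\<mu> * s)) = (\<lambda>s. - 2 * (\<omega> s t * cot (\<mu> * s)))"
    by (simp add: \<omega>_odd[OF t] mult.assoc)
  then show ?thesis
    unfolding strain_def v_z_def hilbert_sym_def by (simp add: integral_mult_right del: times_divide_eq_left)
qed

lemma cot_moment_deriv:
  assumes F: "smooth_spacetime T F" and F0: "\<And>t. t \<in> I \<Longrightarrow> F 0 t = 0" and Ft0: "\<And>t. t \<in> I \<Longrightarrow> dt T F 0 t = 0"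
    and t: "t \<in> I"
  shows "((\<lambda>t. integral {0..L/2} (\<lambda>z. F z t * cot (\<mu> * z))) has_real_derivative
     integral {0..L/2} (\<lambda>z. dt T F z t * cot (\<mu> * z))) (at t within I)"
proof (rule leibniz_cot[where F=F and Fp="dt T F" and Fs="dz F" and Fps="dz (dt T F)", OF L convex_times_upto t])
  fix s p assume p: "p \<in> I"
  show "F 0 p = 0" by (rule F0[OF p])
  show "((\<lambda>s. F s p) has_real_derivative dz F s p) (at s)" by (rule smooth_deriv_z[OF F p])
  show "((\<lambda>p. F s p) has_real_derivative dt T F s p) (at p within I)" by (rule smooth_deriv_t[OF F p])
  show "((\<lambda>s. dt T F s p) has_real_derivative dz (dt T F) s p) (at s)" by (rule smooth_deriv_z[OF smooth_dt[OF F] p])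
  show "((\<lambda>p. dz F 0 p) has_real_derivative dz (dt T F) 0 p) (at p within I)"
    unfolding smooth_mixed_partials[OF F p] by (rule smooth_deriv_t[OF smooth_dz[OF F] p])
  show "dt T F 0 p = 0" by (rule Ft0[OF p])
next
  show "continuous_on ({0..L/2} \<times> I) (\<lambda>(s, p). dz F s p)"
    by (rule continuous_on_subset[OF smooth_continuous[OF smooth_dz[OF F]]]) auto
  show "continuous_on ({0..L/2} \<times> I) (\<lambda>(s, p). dz (dt T F) s p)"
    by (rule continuous_on_subset[OF smooth_continuous[OF smooth_dz[OF smooth_dt[OF F]]]]) auto
qed

lemma \<omega>_at_zero: "t \<in> I \<Longrightarrow> \<omega> 0 t = 0"
  using \<omega>_odd[of t 0] by simp

lemma \<omega>_t_at_zero: "t \<in> I \<Longrightarrow> dt T \<omega> 0 t = 0"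
  by (simp add: \<omega>_eq u_z_at_zero v_at_zero)

lemma u_zt_at_zero: "t \<in> I \<Longrightarrow> dt T (dz u) 0 t = 0"
  by (simp add: u_z_eq u_z_at_zero v_at_zero)

lemma smooth_cot_integrable:
  assumes F: "smooth_spacetime T F" and t: "t \<in> I" and F0: "F 0 t = 0"
  shows "(\<lambda>z. F z t * cot (\<mu> * z)) integrable_on {0..L/2}"
  by (rule integrable_cot[OF L, where F'="\<lambda>z. dz F z t"])
    (use F0 in \<open>auto intro!: DERIV_subset[OF smooth_deriv_z[OF F t]] smooth_continuous_z[OF smooth_dz[OF F] t]\<close>)

text \<open>Since \<open>v \<omega> cot\<close> vanishes at both ends of the half period, \<open>- \<integral> v \<omega>_z cot = \<integral> \<omega> (v cot)_z \<ge> 0\<close>.\<close>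

lemma strain_deriv:
  assumes t: "t \<in> I"
  obtains f' where "(strain has_real_derivative f') (at t within I)" "f' \<ge> gradient_moment t"
proof
  let ?N = "\<lambda>z. dt T \<omega> z t * cot (\<mu> * z) - dz u z t * cot (\<mu> * z)"
  show "(strain has_real_derivative 2 / L * integral {0..L/2} (\<lambda>z. dt T \<omega> z t * cot (\<mu> * z))) (at t within I)"
    unfolding strain_def[abs_def]
    by (intro DERIV_cmult cot_moment_deriv[OF \<omega>_smooth \<omega>_at_zero \<omega>_t_at_zero t])
  have i: "(\<lambda>z. dt T \<omega> z t * cot (\<mu> * z)) integrable_on {0..L/2}" "(\<lambda>z. dz u z t * cot (\<mu> * z)) integrable_on {0..L/2}"
    by (rule smooth_cot_integrable[OF _ t]; simp add: smooth_dt smooth_dz \<omega>_smooth u_smooth \<omega>_t_at_zero[OF t] u_z_at_zero[OF t])+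
  have N: "?N z = - (v z t * dz \<omega> z t * cot (\<mu> * z))" for z
    by (simp add: \<omega>_eq[OF t] algebra_simps)
  let ?F' = "\<lambda>z. - (v_z z t * \<omega> z t + dz \<omega> z t * v z t)"
  let ?\<Theta> = "cot_ext L (?F' 0) (\<lambda>z. - (v z t * \<omega> z t))"
  have dF: "((\<lambda>z. - (v z t * \<omega> z t)) has_real_derivative ?F' z) (at z)" for z
    by (intro DERIV_minus DERIV_mult v_deriv[OF t] \<omega>_deriv[OF t])
  have vc: "continuous_on S (\<lambda>z. v z t)" "continuous_on S (\<lambda>z. v_z z t)" for S
    by (rule DERIV_continuous_on, rule DERIV_subset[OF v_deriv[OF t]] DERIV_subset[OF v_z_deriv[OF t]], simp)+
  have c\<Theta>: "continuous_on {0..L/2} ?\<Theta>"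
    by (rule cot_ext_continuous1[OF L DERIV_subset[OF dF]])
      (auto simp: v_at_zero[OF t] intro!: continuous_intros vc smooth_continuous_z[OF \<omega>_smooth t] smooth_continuous_z[OF smooth_dz[OF \<omega>_smooth] t])
  \<comment> \<open>Outside the open interval the value is immaterial for the integral; the integrand of \<open>f' - g\<close> makes the comparison below trivial there.\<close>
  define \<Theta>' where "\<Theta>' z = (if z \<in> {0<..<L/2} then ?F' z * cot (\<mu> * z) + \<mu> * v z t * \<omega> z t / (sin (\<mu> * z))\<^sup>2 else ?N z)" for z
  have "(\<Theta>' has_integral (?\<Theta> (L/2) - ?\<Theta> 0)) {0..L/2}"
  proof (rule fundamental_theorem_of_calculus_interior[OF _ c\<Theta>])
    fix z assume z: "z \<in> {0<..<L/2}"
    have s: "sin (\<mu> * z) \<noteq> 0" using sin_cos_pos_quarter[of z L] z by auto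
    have "((\<lambda>z. - (v z t * \<omega> z t) * cot (\<mu> * z)) has_real_derivative
       ?F' z * cot (\<mu> * z) + - \<mu> / (sin (\<mu> * z))\<^sup>2 * (- (v z t * \<omega> z t))) (at z)"
      by (rule DERIV_mult[OF dF cot_deriv_scaled[OF s]])
    then have "((\<lambda>z. - (v z t * \<omega> z t) * cot (\<mu> * z)) has_real_derivative \<Theta>' z) (at z)"
      by (rule DERIV_cong) (use z in \<open>simp only: \<Theta>'_def if_True; simp\<close>)
    then have "(?\<Theta> has_real_derivative \<Theta>' z) (at z)"
      by (rule has_field_derivative_transform_within_open[of _ _ _ "{0<..<L/2}"]) (use z in \<open>auto simp: cot_ext_def\<close>)
    then show "(?\<Theta> has_vector_derivative \<Theta>' z) (at z)"
      by (simp only: has_real_derivative_iff_has_vector_derivative)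
  qed (use L in simp)
  moreover have "?\<Theta> (L/2) = 0" using L by (simp add: cot_ext_def v_at_half[OF t])
  moreover have "?\<Theta> 0 = 0" by (simp add: cot_ext_def v_at_zero[OF t] \<omega>_at_zero[OF t])
  ultimately have \<Theta>': "(\<Theta>' has_integral 0) {0..L/2}" by simp
  have "0 \<le> integral {0..L/2} ?N"
  proof (rule has_integral_le[OF \<Theta>' integrable_integral])
    show "?N integrable_on {0..L/2}" by (intro integrable_diff i)
    show "\<Theta>' z \<le> ?N z" if "z \<in> {0..L/2}" for z
    proof (cases "z \<in> {0<..<L/2}")
      case True
      have "?N z - \<Theta>' z = \<omega> z t * (v_z z t * cot (\<mu> * z) - \<mu> * v z t / (sin (\<mu> * z))\<^sup>2)"
        unfolding N using True by (simp only: \<Theta>'_def if_True) (simp add: algebra_simps)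
      also have "\<dots> \<ge> 0" using v_cot_increasing[OF t, of z] \<omega>_nonneg[OF t, of z] True by (intro mult_nonneg_nonneg) auto
      finally show ?thesis by simp
    next
      case False
      then show ?thesis by (simp only: \<Theta>'_def if_False)
    qed
  qed
  also have "integral {0..L/2} ?N = integral {0..L/2} (\<lambda>z. dt T \<omega> z t * cot (\<mu> * z)) - integral {0..L/2} (\<lambda>z. dz u z t * cot (\<mu> * z))"
    by (rule Henstock_Kurzweil_Integration.integral_diff[OF i])
  finally have "integral {0..L/2} (\<lambda>z. dz u z t * cot (\<mu> * z)) \<le> integral {0..L/2} (\<lambda>z. dt T \<omega> z t * cot (\<mu> * z))"
    by simp
  then show "gradient_moment t \<le> 2 / L * integral {0..L/2} (\<lambda>z. dt T \<omega> z t * cot (\<mu> * z))"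
    unfolding gradient_moment_def using L by (intro mult_left_mono) auto
qed

text \<open>With \<open>P\<close> and \<open>W\<close> the integrals of \<open>u_z cot\<close> and \<open>\<omega> cot\<close> over \<open>[z, L/2]\<close>, the monotonicity of \<open>\<omega>/u_z\<close> gives
  \<open>u_z cot W \<ge> \<omega> cot P\<close>, so that \<open>u_z cot W\<close> is at least half of \<open>- (P W)_z\<close>. The integrand of \<open>g'\<close> therefore dominates the derivative
  of \<open>\<Xi> = - v u_z cot - P W / L\<close>, whose boundary values give \<open>f g / 2\<close>.\<close>

lemma gradient_moment_deriv:
  assumes t: "t \<in> I"
  obtains g' where "(gradient_moment has_real_derivative g') (at t within I)" "g' \<ge> strain t * gradient_moment t / 2"
proof
  let ?N = "\<lambda>z. dt T (dz u) z t * cot (\<mu> * z)"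
  show "(gradient_moment has_real_derivative 2 / L * integral {0..L/2} ?N) (at t within I)"
    unfolding gradient_moment_def[abs_def]
    by (intro DERIV_cmult cot_moment_deriv[OF smooth_dz[OF u_smooth] u_z_at_zero u_zt_at_zero t])
  have i: "?N integrable_on {0..L/2}"
    by (rule smooth_cot_integrable[OF smooth_dt[OF smooth_dz[OF u_smooth]] t u_zt_at_zero[OF t]])
  let ?F' = "\<lambda>z. - (v_z z t * dz u z t + dz (dz u) z t * v z t)"
  let ?\<Theta> = "cot_ext L (?F' 0) (\<lambda>z. - (v z t * dz u z t))"
  have N: "?N z = ?F' z * cot (\<mu> * z)" for z by (simp add: u_z_eq[OF t] algebra_simps)
  have dF: "((\<lambda>z. - (v z t * dz u z t)) has_real_derivative ?F' z) (at z)" for z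
    by (intro DERIV_minus DERIV_mult v_deriv[OF t] u_z_deriv[OF t])
  have vc: "continuous_on S (\<lambda>z. v z t)" "continuous_on S (\<lambda>z. v_z z t)" for S
    by (rule DERIV_continuous_on, rule DERIV_subset[OF v_deriv[OF t]] DERIV_subset[OF v_z_deriv[OF t]], simp)+
  have c\<Theta>: "continuous_on {0..L/2} ?\<Theta>"
    by (rule cot_ext_continuous1[OF L DERIV_subset[OF dF]])
      (auto simp: v_at_zero[OF t] intro!: continuous_intros vc smooth_continuous_z[OF smooth_dz[OF u_smooth] t]
        smooth_continuous_z[OF smooth_dz[OF smooth_dz[OF u_smooth]] t])
  define e1 where "e1 = cot_ext L (dz (dz u) 0 t) (\<lambda>z. dz u z t)"
  define e2 where "e2 = cot_ext L (dz \<omega> 0 t) (\<lambda>z. \<omega> z t)"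
  have ce: "continuous_on {0..L/2} e1" "continuous_on {0..L/2} e2"
    unfolding e1_def e2_def
    by (rule cot_ext_continuous1[OF L, where F'="\<lambda>z. dz (dz u) z t"] cot_ext_continuous1[OF L, where F'="\<lambda>z. dz \<omega> z t"];
      auto simp: u_z_at_zero[OF t] \<omega>_at_zero[OF t] intro!: DERIV_subset[OF u_z_deriv[OF t]] DERIV_subset[OF \<omega>_deriv[OF t]]
        smooth_continuous_z smooth_dz u_smooth \<omega>_smooth t)+
  have e: "e1 z = dz u z t * cot (\<mu> * z)" "e2 z = \<omega> z t * cot (\<mu> * z)" if "z \<noteq> 0" for z
    using that by (simp_all add: e1_def e2_def cot_ext_def)
  define P where "P z = integral {z..L/2} e1" for z
  define W where "W z = integral {z..L/2} e2" for z
  have GW: "G z t = 2 / L * W z" for z unfolding G_def W_def e2_def integral_cot_ext ..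
  have fW: "strain t = 2 / L * W 0" unfolding strain_def W_def e2_def integral_cot_ext ..
  have gP: "gradient_moment t = 2 / L * P 0" unfolding gradient_moment_def P_def e1_def integral_cot_ext ..
  define \<Xi> where "\<Xi> z = ?\<Theta> z - 1 / L * (P z * W z)" for z
  have c\<Xi>: "continuous_on {0..L/2} \<Xi>"
    unfolding \<Xi>_def P_def W_def by (intro continuous_intros c\<Theta> tail_integral(2) ce)
  define \<Xi>' where "\<Xi>' z = (if z \<in> {0<..<L/2} then ?F' z * cot (\<mu> * z) + \<mu> * v z t * dz u z t / (sin (\<mu> * z))\<^sup>2
     + 1 / L * (e1 z * W z + e2 z * P z) else ?N z)" for z
  have "(\<Xi>' has_integral (\<Xi> (L/2) - \<Xi> 0)) {0..L/2}"
  proof (rule fundamental_theorem_of_calculus_interior[OF _ c\<Xi>])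
    fix z assume z: "z \<in> {0<..<L/2}"
    have s: "sin (\<mu> * z) \<noteq> 0" using sin_cos_pos_quarter[of z L] z by auto
    have "((\<lambda>z. - (v z t * dz u z t) * cot (\<mu> * z)) has_real_derivative
       ?F' z * cot (\<mu> * z) + - \<mu> / (sin (\<mu> * z))\<^sup>2 * (- (v z t * dz u z t))) (at z)"
      by (rule DERIV_mult[OF dF cot_deriv_scaled[OF s]])
    then have "(?\<Theta> has_real_derivative ?F' z * cot (\<mu> * z) + - \<mu> / (sin (\<mu> * z))\<^sup>2 * (- (v z t * dz u z t))) (at z)"
      by (rule has_field_derivative_transform_within_open[of _ _ _ "{0<..<L/2}"]) (use z in \<open>auto simp: cot_ext_def\<close>)
    moreover have "((\<lambda>z. P z * W z) has_real_derivative - e1 z * W z + - e2 z * P z) (at z)"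
      unfolding P_def W_def by (rule DERIV_mult[OF tail_integral(1)[OF ce(1) z] tail_integral(1)[OF ce(2) z]])
    ultimately have "(\<Xi> has_real_derivative ?F' z * cot (\<mu> * z) + - \<mu> / (sin (\<mu> * z))\<^sup>2 * (- (v z t * dz u z t))
       - 1 / L * (- e1 z * W z + - e2 z * P z)) (at z)"
      unfolding \<Xi>_def[abs_def] by (intro DERIV_diff DERIV_cmult)
    then have "(\<Xi> has_real_derivative \<Xi>' z) (at z)"
      by (rule DERIV_cong) (use z in \<open>simp only: \<Xi>'_def if_True; simp add: field_simps\<close>)
    then show "(\<Xi> has_vector_derivative \<Xi>' z) (at z)"
      by (simp only: has_real_derivative_iff_has_vector_derivative)
  qed (use L in simp)
  moreover have "\<Xi> (L/2) = 0" using L by (simp add: \<Xi>_def cot_ext_def v_at_half[OF t] P_def)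
  moreover have "\<Xi> 0 = - (1 / L * (P 0 * W 0))" by (simp add: \<Xi>_def cot_ext_def v_at_zero[OF t] u_z_at_zero[OF t])
  ultimately have \<Xi>': "(\<Xi>' has_integral 1 / L * (P 0 * W 0)) {0..L/2}" by simp
  have "1 / L * (P 0 * W 0) \<le> integral {0..L/2} ?N"
  proof (rule has_integral_le[OF \<Xi>' integrable_integral[OF i]])
    fix z assume "z \<in> {0..L/2}"
    show "\<Xi>' z \<le> ?N z"
    proof (cases "z \<in> {0<..<L/2}")
      case True
      then have z: "0 < z" "z < L/2" by auto
      note sc = sin_cos_pos_quarter[OF z]
      have cz: "cot (\<mu> * z) \<ge> 0" using cot_bounds_half[of z L] z by simp
      have uz: "dz u z t \<ge> 0" using u_z_nonneg[OF t, of z] z by auto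
      have int: "e1 integrable_on {z..L/2}" "e2 integrable_on {z..L/2}"
        by (rule integrable_continuous_interval[OF continuous_on_subset[OF ce(1)]]
            integrable_continuous_interval[OF continuous_on_subset[OF ce(2)]]; use z in auto)+
      have "\<omega> z t * P z \<le> dz u z t * W z"
        unfolding P_def W_def integral_mult_right[symmetric]
      proof (rule integral_le)
        fix y assume y: "y \<in> {z..L/2}"
        have "\<omega> z t * dz u y t * cot (\<mu> * y) \<le> \<omega> y t * dz u z t * cot (\<mu> * y)"
          using ratio_increasing[OF t, of z y] y z cot_bounds_half[of y L] by (intro mult_right_mono) auto
        then show "\<omega> z t * e1 y \<le> dz u z t * e2 y" using e[of y] y z by (simp add: mult_ac)
      qed (use int integrable_on_mult_right in blast)+
      then have "cot (\<mu> * z) * (\<omega> z t * P z) \<le> cot (\<mu> * z) * (dz u z t * W z)" using cz by (intro mult_left_mono)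
      then have PW: "e2 z * P z \<le> e1 z * W z" using e[of z] z by (simp add: mult_ac)
      have "\<mu> * v z t \<le> - (sin (\<mu> * z) * cos (\<mu> * z) * G z t)" by (rule v_upper_bound[OF t z])
      then have "dz u z t / (sin (\<mu> * z))\<^sup>2 * (\<mu> * v z t) \<le> dz u z t / (sin (\<mu> * z))\<^sup>2 * - (sin (\<mu> * z) * cos (\<mu> * z) * G z t)"
        using uz by (intro mult_left_mono) auto
      also have "\<dots> = - (2 / L * (e1 z * W z))"
        unfolding GW using e(1)[of z] z sc by (simp add: cot_def power2_eq_square mult_ac)
      finally have "\<mu> * v z t * dz u z t / (sin (\<mu> * z))\<^sup>2 \<le> - (2 / L * (e1 z * W z))" by (simp add: mult_ac)
      moreover have "1 / L * (e1 z * W z + e2 z * P z) \<le> 1 / L * (e1 z * W z + e1 z * W z)"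
        using L by (intro mult_left_mono add_left_mono PW) simp
      moreover have "1 / L * (e1 z * W z + e1 z * W z) = 2 / L * (e1 z * W z)" by simp
      moreover have "\<Xi>' z = ?N z + \<mu> * v z t * dz u z t / (sin (\<mu> * z))\<^sup>2 + 1 / L * (e1 z * W z + e2 z * P z)"
        unfolding N using True by (simp only: \<Xi>'_def if_True)
      ultimately show ?thesis by linarith
    next
      case False
      then show ?thesis by (simp only: \<Xi>'_def if_False)
    qed
  qed
  then have "2 / L * (1 / L * (P 0 * W 0)) \<le> 2 / L * integral {0..L/2} ?N"
    using L by (intro mult_left_mono) auto
  then show "strain t * gradient_moment t / 2 \<le> 2 / L * integral {0..L/2} ?N"
    unfolding fW gP by (simp add: mult_ac)
qed

lemma strain_nonneg: "t \<in> I \<Longrightarrow> strain t \<ge> 0"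
  using G_nonneg[of t 0] by (simp add: strain_def G_def)

lemma gradient_moment_init: "gradient_moment 0 = a * \<mu>"
proof -
  have "((\<lambda>z. a * \<mu> * (1 + cos (2 * (\<mu> * z)))) has_integral
      a * \<mu> * (L/2 + sin (2 * (\<mu> * (L/2))) / (2 * \<mu>)) - a * \<mu> * (0 + sin (2 * (\<mu> * 0)) / (2 * \<mu>))) {0..L/2}"
    by (rule fundamental_theorem_of_calculus)
      (use L in \<open>auto intro!: derivative_eq_intros simp: has_real_derivative_iff_has_vector_derivative[symmetric]\<close>)
  moreover have "2 * (\<mu> * (L/2)) = pi" using L by simp
  ultimately have "((\<lambda>z. a * \<mu> * (1 + cos (2 * (\<mu> * z)))) has_integral a * \<mu> * (L/2)) {0..L/2}"
    using L by simp
  then have "((\<lambda>z. dz u z 0 * cot (\<mu> * z)) has_integral a * \<mu> * (L/2)) {0..L/2}"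
  proof (rule has_integral_spike_finite[of "{0}", rotated 2])
    fix z assume z: "z \<in> {0..L/2} - {0}"
    then have s: "sin (\<mu> * z) \<noteq> 0" using sin_pos_half[of z L] by auto
    have "dz u z 0 * cot (\<mu> * z) = a * \<mu> * (2 * (cos (\<mu> * z))\<^sup>2)"
      unfolding u_z_init sin_double cot_def using s by (simp add: power2_eq_square)
    then show "dz u z 0 * cot (\<mu> * z) = a * \<mu> * (1 + cos (2 * (\<mu> * z)))"
      unfolding cos_double_cos by simp
  qed simp
  then show ?thesis unfolding gradient_moment_def using L by (simp only: integral_unique) simp
qed

lemma v_z_lower_bound:
  assumes c: "c > 0" "c\<^sup>2 \<le> a * \<mu>" and t: "t \<in> I" "c * t < pi"
  shows "- v_z 0 t \<ge> 2 * c * tan (c * t / 2)"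
proof -
  have sub: "{0..t} \<subseteq> I" and t0: "t \<ge> 0" using times_upto_interval[OF t(1)] t(1) by (auto simp: times_upto_def)
  have "\<forall>s. \<exists>d. s \<in> I \<longrightarrow> (strain has_real_derivative d) (at s within I) \<and> d \<ge> gradient_moment s" using strain_deriv by metis
  then obtain f' where f': "\<And>s. s \<in> I \<Longrightarrow> (strain has_real_derivative f' s) (at s within I)" "\<And>s. s \<in> I \<Longrightarrow> f' s \<ge> gradient_moment s"
    by metis
  have "\<forall>s. \<exists>d. s \<in> I \<longrightarrow> (gradient_moment has_real_derivative d) (at s within I) \<and> d \<ge> strain s * gradient_moment s / 2" using gradient_moment_deriv by metis
  then obtain g' where g': "\<And>s. s \<in> I \<Longrightarrow> (gradient_moment has_real_derivative g' s) (at s within I)" "\<And>s. s \<in> I \<Longrightarrow> g' s \<ge> strain s * gradient_moment s / 2"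
    by metis
  have "strain t \<ge> 2 * c * tan (c * t / 2)"
  proof (rule tan_comparison[OF c(1) t(2), where f'=f' and g=gradient_moment and g'=g'])
    fix s assume "s \<in> {0..t}"
    then have s: "s \<in> I" using sub by auto
    show "(strain has_real_derivative f' s) (at s within {0..t})" by (rule DERIV_subset[OF f'(1)[OF s] sub])
    show "(gradient_moment has_real_derivative g' s) (at s within {0..t})" by (rule DERIV_subset[OF g'(1)[OF s] sub])
  qed (use sub t0 f'(2) g'(2) strain_nonneg c(2) gradient_moment_init in auto)
  then show ?thesis unfolding strain_eq[OF t(1)] .
qed

text \<open>At the time \<open>t < \<pi>/c\<close> at which \<open>c tan (c t / 2)\<close> equals a positive bound for \<open>|v_z|\<close> on \<open>[0, \<pi>/c]\<close>, the lower bound is twice that bound.\<close>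

lemma blowup_time:
  assumes c: "c > 0" "c\<^sup>2 \<le> a * \<mu>"
  shows "T \<le> ereal (pi / c)"
proof (rule ccontr)
  assume "\<not> T \<le> ereal (pi / c)"
  then have t1: "pi / c \<in> I" using c by (simp add: times_upto_def)
  obtain K where K: "\<And>z t. t \<in> {0..pi / c} \<Longrightarrow> \<bar>v_z z t\<bar> \<le> K" using v_z_bounded[OF t1] by blast
  define K' where "K' = max 1 K"
  define \<theta> where "\<theta> = arctan (K' / c)"
  have \<theta>: "0 < \<theta>" "\<theta> < pi / 2" using c arctan_ubound by (auto simp: \<theta>_def K'_def zero_less_arctan_iff)
  define t where "t = 2 * \<theta> / c"
  have ct: "c * t = 2 * \<theta>" using c by (simp add: t_def)
  have t: "t \<in> {0..pi / c}" using \<theta> c by (auto simp: t_def divide_right_mono)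
  then have tI: "t \<in> I" using times_upto_interval[OF t1] by auto
  have "- v_z 0 t \<ge> 2 * c * tan (c * t / 2)"
    by (rule v_z_lower_bound[OF c tI]) (use ct \<theta> in simp)
  also have "2 * c * tan (c * t / 2) = 2 * K'" using c unfolding ct by (simp add: \<theta>_def tan_arctan)
  finally show False using K[OF t, of 0] by (simp add: K'_def abs_le_iff)
qed

end

theorem mainTheorem4:
  fixes L \<mu> a c0 :: real and T :: ereal and u \<omega> v :: "real \<Rightarrow> real \<Rightarrow> real"
  assumes "L > 0" and "\<mu> = pi / L" and "a > 0" and "T > 0"
    and "smooth_solution L T u \<omega> v"
    and "\<And>z. u z 0 = a * (sin (\<mu> * z))\<^sup>2"
    and "\<And>z. \<omega> z 0 = 0"
    and "\<And>z t. z \<in> {0<..<L/2} \<Longrightarrow> t \<in> times_upto T \<Longrightarrow> dz (dz v) z t \<ge> 0"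
    and "c0 = sqrt (\<mu> / L * integral {0..L} (\<lambda>z. u z 0 * (cot (\<mu> * z))\<^sup>2))"
  shows "c0 = sqrt (a * \<mu> / 2) \<and>
    (\<forall>t\<in>times_upto T. - dz v 0 t = \<bar>dz v 0 t\<bar> \<and> \<bar>dz v 0 t\<bar> \<ge> 2 * c0 * tan (c0 * t / 2)) \<and>
    T \<le> ereal (pi / c0) \<and>
    pi / c0 = sqrt (2 * pi * L / a)"
proof -
  interpret convex_solution L a T u \<omega> v
    by unfold_locales (use assms in auto)
  note \<mu> = \<open>\<mu> = pi / L\<close>
  have "((\<lambda>z. a / 2 * (1 + cos (2 * (\<mu> * z)))) has_integral
      a / 2 * (L + sin (2 * (\<mu> * L)) / (2 * \<mu>)) - a / 2 * (0 + sin (2 * (\<mu> * 0)) / (2 * \<mu>))) {0..L}"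
    by (rule fundamental_theorem_of_calculus)
      (use assms(1) in \<open>auto intro!: derivative_eq_intros simp: \<mu> has_real_derivative_iff_has_vector_derivative[symmetric]\<close>)
  moreover have "\<mu> * L = pi" using assms(1) \<mu> by simp
  ultimately have "((\<lambda>z. a / 2 * (1 + cos (2 * (\<mu> * z)))) has_integral a * L / 2) {0..L}" by simp
  then have "((\<lambda>z. u z 0 * (cot (\<mu> * z))\<^sup>2) has_integral a * L / 2) {0..L}"
  proof (rule has_integral_spike_finite[of "{0, L}", rotated 2])
    fix z assume "z \<in> {0..L} - {0, L}"
    then have "sin (\<mu> * z) \<noteq> 0" using sin_pos_half[of z L] \<mu> by auto
    then have "u z 0 * (cot (\<mu> * z))\<^sup>2 = a * (cos (\<mu> * z))\<^sup>2"
      unfolding assms(6) cot_def by (simp add: power_divide)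
    then show "u z 0 * (cot (\<mu> * z))\<^sup>2 = a / 2 * (1 + cos (2 * (\<mu> * z)))"
      by (simp add: cos_double_cos)
  qed simp
  then have c0: "c0 = sqrt (a * \<mu> / 2)"
    unfolding assms(9) using assms(1) by (simp only: integral_unique) (simp add: mult_ac)
  have \<mu>0: "\<mu> > 0" using assms(1) \<mu> by simp
  have c0_pos: "c0 > 0" using c0 assms(3) \<mu>0 by simp
  have "a * \<mu> \<ge> 0" using assms(3) \<mu>0 by simp
  then have c0_2: "c0\<^sup>2 = a * \<mu> / 2" unfolding c0 by simp
  then have c0_sq: "c0\<^sup>2 \<le> a * (pi / L)" using \<open>a * \<mu> \<ge> 0\<close> unfolding \<mu> by simp
  have T_le: "T \<le> ereal (pi / c0)" by (rule blowup_time[OF c0_pos c0_sq])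
  have "- dz v 0 t = \<bar>dz v 0 t\<bar> \<and> \<bar>dz v 0 t\<bar> \<ge> 2 * c0 * tan (c0 * t / 2)" if t: "t \<in> times_upto T" for t
  proof -
    have "ereal t < ereal (pi / c0)" using t T_le unfolding times_upto_def by (blast intro: less_le_trans)
    then have "c0 * t < pi" using c0_pos by (simp add: pos_less_divide_eq mult.commute)
    then have "- v_z 0 t \<ge> 2 * c0 * tan (c0 * t / 2)" by (rule v_z_lower_bound[OF c0_pos c0_sq t])
    moreover have "- v_z 0 t \<ge> 0" using strain_nonneg[OF t] strain_eq[OF t] by simp
    ultimately show ?thesis unfolding dz_v[OF t] by simp
  qed
  moreover have "pi / c0 = sqrt (2 * pi * L / a)"
  proof (rule real_sqrt_unique[symmetric])
    have "c0\<^sup>2 = a * pi / (2 * L)" unfolding c0_2 \<mu> by simp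
    then show "(pi / c0)\<^sup>2 = 2 * pi * L / a"
      unfolding power_divide using assms(1,3) by (simp add: power2_eq_square)
  qed (use c0_pos in simp)
  ultimately show ?thesis using c0 T_le by blast
qed

end
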